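(* Let $J\subset\mathbb{R}$ be a bounded open interval, $x_0\in\overline{J}$, and let $f\in W^{1,2}(J)$ be complex-valued with $f(x)\neq0$ for all $x\in\overline{J}$ and $f(x_0)=1$. Then the following statements hold: (i) $y^{[1]}_{\sigma_f}(x)=\mathbf{D}_f y(x)-y(x)\int_{x_0}^x\left(\frac{f'(t)}{f(t)}\right)^2dt$ for $y\in W^{1,2}(J)$. (ii) $y^{[1]}_{\sigma_f}(x_0)=\mathbf{D}_f y(x_0)$ for $y\in W^{1,2}(J)$. (iii) $\mathscr{D}_2(\mathbf{S}_f)=\{y\in W^{1,2}(J)\,|\,\mathbf{D}_f y\in W^{1,2}(J)\}$. (iv) The operator $\mathscr{D}_2(\mathbf{S}_f)\ni y\mapsto \frac{y}{f}\in W^{2,2}(J)$ is a bijection. (v) $\mathbf{S}_f y=-\mathbf{D}_{\frac1f}\mathbf{D}_f y$ for $y\in\mathscr{D}_2(\mathbf{S}_f)$.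
   Context: All functions are complex-valued. $W^{-1,2}(J)$ is the topological dual of $W_0^{1,2}(J)$ with (bilinear) action $(\cdot|\cdot)$. The distribution $q_f=\frac{f''}{f}\in W^{-1,2}(J)$ is given by $(q_f|\phi)=\int_J\{(f'/f)^2\phi-(f'/f)\phi'\}\,dx$, $\phi\in W^{1,2}_0(J)$; thus $f$ is a nonvanishing solution of $-f''+q_ff=0$. For $y\in W^{1,2}(J)$, $\mathbf{S}_f y\in W^{-1,2}(J)$ is the Schrödinger expression $-y''+q_fy$, defined by $(\mathbf{S}_f y|\phi)=\int_J y'\phi'\,dx+(q_f|y\phi)$, $\phi\in W_0^{1,2}(J)$. $\mathscr{D}_2(\mathbf{S}_f)$ is the set of $y\in W^{1,2}(J)$ for which $\mathbf{S}_f y$ is represented by some $g\in L^2(J)$ (i.e. $(\mathbf{S}_fy|\phi)=\int_J g\phi$ for all $\phi$); then one writes $\mathbf{S}_f y=g$. Set $\sigma_f(x)=\frac{f'(x)}{f(x)}+\int_{x_0}^x\left(\frac{f'(t)}{f(t)}\right)^2dt\in L^2(J)$ (an antiderivative of $q_f$). For $y\in W^{1,2}(J)$, the $\sigma_f$-quasiderivative is $y^{[1]}_{\sigma_f}:=y'-\sigma_f y$, and $\mathbf{D}_f y:=f\,(y/f)'=y'-\frac{f'}{f}y$, $\mathbf{D}_{\frac1f}y:=\frac1f(fy)'=y'+\frac{f'}{f}y$. *)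

theory Defs
  imports "HOL-Analysis.Analysis"
begin

text \<open>
  Elements of Lebesgue and Sobolev spaces on an open set \<open>J\<close> are represented by functions on the
  whole real line; only their values almost everywhere on \<open>J\<close> are relevant, and the spaces below
  are closed under changing a function on a null set and outside \<open>J\<close>.
\<close>

definition ae_rel :: "real set \<Rightarrow> ((real \<Rightarrow> complex) \<times> (real \<Rightarrow> complex)) set" where
  "ae_rel J = {(u, v). u \<in> borel_measurable (lebesgue_on J) \<and> v \<in> borel_measurable (lebesgue_on J) \<and>
     (AE x in lebesgue_on J. u x = v x)}"

definition L2 :: "real set \<Rightarrow> (real \<Rightarrow> complex) set" where
  "L2 J = {u. u \<in> borel_measurable (lebesgue_on J) \<and> integrable (lebesgue_on J) (\<lambda>x. (cmod (u x))\<^sup>2)}"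

definition locally_integrable :: "real set \<Rightarrow> (real \<Rightarrow> complex) \<Rightarrow> bool" where
  "locally_integrable J u \<longleftrightarrow> (\<forall>K. compact K \<and> K \<subseteq> J \<longrightarrow> u absolutely_integrable_on K)"

text \<open>The space of smooth functions with compact support in \<open>J\<close>; \<open>D n\<close> is the \<open>n\<close>-th derivative.\<close>

definition test_functions :: "real set \<Rightarrow> (real \<Rightarrow> complex) set" where
  "test_functions J = {\<phi>.
     (\<exists>D. D 0 = \<phi> \<and> (\<forall>n x. (D n has_vector_derivative D (Suc n) x) (at x))) \<and>
     compact (closure {x. \<phi> x \<noteq> 0}) \<and> closure {x. \<phi> x \<noteq> 0} \<subseteq> J}"

definition has_weak_derivative :: "real set \<Rightarrow> (real \<Rightarrow> complex) \<Rightarrow> (real \<Rightarrow> complex) \<Rightarrow> bool" where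
  "has_weak_derivative J u v \<longleftrightarrow> locally_integrable J u \<and> locally_integrable J v \<and>
     (\<forall>\<phi>\<in>test_functions J.
        (LINT x|lebesgue_on J. u x * vector_derivative \<phi> (at x)) = - (LINT x|lebesgue_on J. v x * \<phi> x))"

text \<open>A representative of the weak derivative, which is unique up to null sets whenever it exists.\<close>

definition wderiv :: "real set \<Rightarrow> (real \<Rightarrow> complex) \<Rightarrow> real \<Rightarrow> complex" where
  "wderiv J u = (SOME v. has_weak_derivative J u v)"

text \<open>\<open>sobolev k J\<close> is \<open>W\<^sup>k\<^sup>,\<^sup>2(J)\<close>.\<close>

primrec sobolev :: "nat \<Rightarrow> real set \<Rightarrow> (real \<Rightarrow> complex) set" where
  "sobolev 0 J = L2 J"
| "sobolev (Suc k) J = {u \<in> L2 J. \<exists>v\<in>sobolev k J. has_weak_derivative J u v}"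

definition W12_norm :: "real set \<Rightarrow> (real \<Rightarrow> complex) \<Rightarrow> real" where
  "W12_norm J u = sqrt ((LINT x|lebesgue_on J. (cmod (u x))\<^sup>2) + (LINT x|lebesgue_on J. (cmod (wderiv J u x))\<^sup>2))"

text \<open>\<open>W\<^sub>0\<^sup>1\<^sup>,\<^sup>2(J)\<close>, the closure of the test functions in \<open>W\<^sup>1\<^sup>,\<^sup>2(J)\<close>.\<close>

definition sobolev0 :: "real set \<Rightarrow> (real \<Rightarrow> complex) set" where
  "sobolev0 J = {u \<in> sobolev 1 J. \<exists>\<psi>. (\<forall>n. \<psi> n \<in> test_functions J) \<and>
     (\<lambda>n. W12_norm J (\<lambda>x. u x - \<psi> n x)) \<longlonglongrightarrow> 0}"

text \<open>The pairings \<open>(q\<^sub>f|\<phi>)\<close> and \<open>(S\<^sub>f y|\<phi>)\<close>, for \<open>\<phi> \<in> sobolev0 J\<close>.\<close>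

definition q_dist :: "real set \<Rightarrow> (real \<Rightarrow> complex) \<Rightarrow> (real \<Rightarrow> complex) \<Rightarrow> complex" where
  "q_dist J f \<phi> = (LINT x|lebesgue_on J.
     (wderiv J f x / f x)\<^sup>2 * \<phi> x - (wderiv J f x / f x) * wderiv J \<phi> x)"

definition S_dist :: "real set \<Rightarrow> (real \<Rightarrow> complex) \<Rightarrow> (real \<Rightarrow> complex) \<Rightarrow> (real \<Rightarrow> complex) \<Rightarrow> complex" where
  "S_dist J f y \<phi> = (LINT x|lebesgue_on J. wderiv J y x * wderiv J \<phi> x) + q_dist J f (\<lambda>x. y x * \<phi> x)"

text \<open>\<open>S\<^sub>f y = g\<close> in the sense that \<open>g\<close> is square integrable and represents the functional \<open>S\<^sub>f y\<close>.\<close>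

definition S_eq :: "real set \<Rightarrow> (real \<Rightarrow> complex) \<Rightarrow> (real \<Rightarrow> complex) \<Rightarrow> (real \<Rightarrow> complex) \<Rightarrow> bool" where
  "S_eq J f y g \<longleftrightarrow> g \<in> L2 J \<and>
     (\<forall>\<phi>\<in>sobolev0 J. S_dist J f y \<phi> = (LINT x|lebesgue_on J. g x * \<phi> x))"

definition S_domain :: "real set \<Rightarrow> (real \<Rightarrow> complex) \<Rightarrow> (real \<Rightarrow> complex) set" where
  "S_domain J f = {y \<in> sobolev 1 J. \<exists>g. S_eq J f y g}"

text \<open>\<open>D\<^sub>f y = f (y/f)'\<close>; with \<open>1/f\<close> in place of \<open>f\<close> this gives \<open>(1/f) (f y)'\<close>.\<close>

definition darboux :: "real set \<Rightarrow> (real \<Rightarrow> complex) \<Rightarrow> (real \<Rightarrow> complex) \<Rightarrow> real \<Rightarrow> complex" where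
  "darboux J f y = (\<lambda>x. f x * wderiv J (\<lambda>t. y t / f t) x)"

text \<open>
  The oriented integral of \<open>(f'/f)\<^sup>2\<close> from \<open>x\<^sub>0\<close> to \<open>x\<close>. It is taken with respect to
  \<^const>\<open>lebesgue\<close> rather than \<^const>\<open>lborel\<close>, as \<^const>\<open>wderiv\<close> need not pick a Borel
  measurable representative.
\<close>

definition log_deriv_sq_int :: "real set \<Rightarrow> (real \<Rightarrow> complex) \<Rightarrow> real \<Rightarrow> real \<Rightarrow> complex" where
  "log_deriv_sq_int J f x0 x =
     interval_lebesgue_integral lebesgue (ereal x0) (ereal x) (\<lambda>t. (wderiv J f t / f t)\<^sup>2)"

definition sigma_f :: "real set \<Rightarrow> (real \<Rightarrow> complex) \<Rightarrow> real \<Rightarrow> real \<Rightarrow> complex" where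
  "sigma_f J f x0 x = wderiv J f x / f x + log_deriv_sq_int J f x0 x"

definition quasideriv :: "real set \<Rightarrow> (real \<Rightarrow> complex) \<Rightarrow> (real \<Rightarrow> complex) \<Rightarrow> real \<Rightarrow> complex" where
  "quasideriv J s y x = wderiv J y x - s x * y x"

text \<open>
  The value at a point of the closure of \<open>J\<close> of a function given only almost everywhere on \<open>J\<close>:
  \<open>u\<close> agrees almost everywhere on \<open>J\<close> with a function tending to \<open>c\<close> at that point.
\<close>

definition has_point_value :: "real set \<Rightarrow> (real \<Rightarrow> complex) \<Rightarrow> real \<Rightarrow> complex \<Rightarrow> bool" where
  "has_point_value J u p c \<longleftrightarrow>
     (\<exists>v. (AE x in lebesgue_on J. u x = v x) \<and> (v \<longlongrightarrow> c) (at p within J))"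

end

theory Submission
  imports Defs
begin

text \<open>
  On a bounded interval, \<open>u \<in> W\<^sup>1\<^sup>,\<^sup>2\<close> with weak derivative \<open>v\<close> means that \<open>u\<close> agrees almost
  everywhere with a primitive \<open>U\<close> of \<open>v \<in> L\<^sup>2\<close>, by the lemma of du Bois-Reymond; primitives obey the
  product and quotient rules. With \<open>p = f'/f\<close> and \<open>w = D\<^sub>f y = y' - p y\<close> this gives
  \<open>(S\<^sub>f y|\<phi>) = \<integral> w \<phi>' - p w \<phi>\<close>. Hence \<open>S\<^sub>f y = g \<in> L\<^sup>2\<close> says that \<open>w\<close> has the weak derivative
  \<open>-(g + p w) \<in> L\<^sup>1\<close>; then \<open>w\<close> is bounded, so \<open>p w\<close> and with it \<open>w'\<close> lie in \<open>L\<^sup>2\<close>, and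
  \<open>g = -(w' + p w) = -D\<^bsub>1/f\<^esub> w\<close>. Finally \<open>(y/f)' = w/f\<close> relates \<open>w \<in> W\<^sup>1\<^sup>,\<^sup>2\<close> to \<open>y/f \<in> W\<^sup>2\<^sup>,\<^sup>2\<close>.
\<close>

section \<open>Primitives of integrable functions\<close>

text \<open>The spaces consist of functions known only almost everywhere, and \<open>wderiv\<close>
  is an arbitrary choice. Pointwise calculus is therefore done on primitives and carried back by
  congruences modulo null sets. Only \<open>f\<close> is tied to its continuous representative,
  which makes \<open>1 / f\<close> bounded up to the endpoints. The obstacle is regularity. As long
  as p and w are merely known to lie in L2, their product is only integrable, so the calculus must
  admit primitives of arbitrary integrable functions; restricted to L2 derivatives it would
  presuppose that w lies in W12. For the converse inclusion the pairing has to be computed for every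
  element of \<open>sobolev0\<close>, so integration by parts is extended from test functions to
  their closure. Point values need care as well: for general y, \<open>darboux J f y\<close> is only
  in L2 and may have no value at x0. What does have one is its difference from the quasiderivative,
  namely y times the integral of p squared from x0, and this tends to 0.\<close>

definition has_ac_deriv :: "real \<Rightarrow> real \<Rightarrow> (real \<Rightarrow> complex) \<Rightarrow> (real \<Rightarrow> complex) \<Rightarrow> bool" where
  "has_ac_deriv a b U v \<longleftrightarrow> v absolutely_integrable_on {a..b} \<and>
     (\<forall>x\<in>{a..b}. U x = U a + integral {a..x} v)"

lemma has_ac_derivD:
  assumes "has_ac_deriv a b U v"
  shows "v absolutely_integrable_on {a..b}" and "x \<in> {a..b} \<Longrightarrow> U x = U a + integral {a..x} v"
  using assms unfolding has_ac_deriv_def by blast+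

lemma has_ac_derivI:
  assumes "v absolutely_integrable_on {a..b}" "\<And>x. x \<in> {a..b} \<Longrightarrow> U x = U a + integral {a..x} v"
  shows "has_ac_deriv a b U v"
  using assms unfolding has_ac_deriv_def by blast

lemma has_ac_deriv_increment:
  assumes "has_ac_deriv a b U v" "a \<le> x" "x \<le> y" "y \<le> b"
  shows "U y - U x = integral {x..y} v"
proof -
  have "v integrable_on {a..b}"
    by (intro set_lebesgue_integral_eq_integral has_ac_derivD(1)[OF assms(1)])
  then have "v integrable_on {a..y}"
    by (rule integrable_on_subinterval) (use assms in auto)
  then have "integral {a..x} v + integral {x..y} v = integral {a..y} v"
    using assms by (intro Henstock_Kurzweil_Integration.integral_combine) auto
  moreover have "U x = U a + integral {a..x} v" "U y = U a + integral {a..y} v"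
    using assms by (intro has_ac_derivD(2)[OF assms(1)]; simp)+
  ultimately show ?thesis
    by (simp add: algebra_simps)
qed

lemma has_ac_deriv_continuous_on:
  assumes "has_ac_deriv a b U v"
  shows "continuous_on {a..b} U"
proof -
  have "continuous_on {a..b} (\<lambda>x. U a + integral {a..x} v)"
    by (intro continuous_intros indefinite_integral_continuous_1
        set_lebesgue_integral_eq_integral has_ac_derivD(1)[OF assms])
  then show ?thesis
    by (rule continuous_on_eq) (rule has_ac_derivD(2)[OF assms, symmetric])
qed

lemma absolutely_integrable_continuous_mult:
  fixes g v :: "real \<Rightarrow> complex"
  assumes "continuous_on {a..b} g" "v absolutely_integrable_on {a..b}"
  shows "(\<lambda>x. g x * v x) absolutely_integrable_on {a..b}"
    and "(\<lambda>x. v x * g x) absolutely_integrable_on {a..b}"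
proof -
  show "(\<lambda>x. g x * v x) absolutely_integrable_on {a..b}"
  proof (rule absolutely_integrable_bounded_measurable_product[OF bilinear_times])
    show "g \<in> borel_measurable (lebesgue_on {a..b})"
      by (intro continuous_imp_measurable_on_sets_lebesgue assms) auto
    show "bounded (g ` {a..b})"
      by (intro compact_imp_bounded compact_continuous_image assms compact_Icc)
  qed (use assms in auto)
  then show "(\<lambda>x. v x * g x) absolutely_integrable_on {a..b}"
    by (simp add: mult.commute)
qed

text \<open>Steps shorter than d lead from a to x, and the bounds telescope to e * (G x - G a); then
  e is arbitrary. \<open>G\<close> is a control function, later an indefinite integral, so neither
  \<open>F\<close> nor \<open>G\<close> has to be differentiable.\<close>

lemma constant_if_small_increments:
  fixes F :: "real \<Rightarrow> 'a::real_normed_vector" and G :: "real \<Rightarrow> real"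
  assumes small: "\<And>e. e > 0 \<Longrightarrow> \<exists>d>0. \<forall>x y. a \<le> x \<longrightarrow> x \<le> y \<longrightarrow> y \<le> b \<longrightarrow> y - x < d \<longrightarrow>
      norm (F y - F x) \<le> e * (G y - G x)"
    and x: "x \<in> {a..b}"
  shows "F x = F a"
proof -
  have bound: "norm (F x - F a) \<le> e * (G x - G a)" if e: "e > 0" for e
  proof -
    obtain d where d: "d > 0" and D: "\<And>x y. a \<le> x \<Longrightarrow> x \<le> y \<Longrightarrow> y \<le> b \<Longrightarrow> y - x < d \<Longrightarrow>
      norm (F y - F x) \<le> e * (G y - G x)"
      using small[OF e] by blast
    have step: "norm (F x - F a) \<le> e * (G x - G a)" if "x \<in> {a..b}" "x - a \<le> of_nat n * (d / 2)" for n x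
      using that
    proof (induction n arbitrary: x)
      case (Suc n)
      \<comment> \<open>Half of d keeps the step strictly below d, and the maximum stops the walk at
        a.\<close>
      define z where "z = max a (x - d / 2)"
      have z: "z \<in> {a..b}" "z - a \<le> of_nat n * (d / 2)" "z \<le> x" "x - z < d"
        using Suc.prems d by (auto simp: z_def algebra_simps max_def)
      have "norm (F x - F a) \<le> norm (F x - F z) + norm (F z - F a)"
        by (rule norm_diff_triangle_ineq[of "F x" "F z" "F z" "F a", simplified])
      also have "\<dots> \<le> e * (G x - G z) + e * (G z - G a)"
        using z Suc.prems by (intro add_mono D Suc.IH) auto
      finally show ?case by (simp add: algebra_simps)
    qed auto
    obtain n where "(x - a) / (d / 2) \<le> of_nat n"
      using real_arch_simple by blast
    then show ?thesis
      using d x by (intro step[of _ n]) (auto simp: field_simps)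
  qed
  have "norm (F x - F a) \<le> 0"
  proof (rule field_le_epsilon)
    fix e :: real assume e: "e > 0"
    show "norm (F x - F a) \<le> 0 + e"
    \<comment> \<open>Monotonicity of \<open>G\<close> is not assumed. If its increment is not
      positive, the bound with e = 1 already forces the norm to vanish; otherwise the increment can
      be divided out.\<close>
    proof (cases "G x - G a \<le> 0")
      case True
      then show ?thesis
        using bound[of 1] e by auto
    next
      case False
      then show ?thesis
        using bound[of "e / (G x - G a)"] e by auto
    qed
  qed
  then show ?thesis by simp
qed

text \<open>The defect U - \<integral> v has increments dominated by e times those of \<integral> h,
  hence is constant. This reduces each calculus rule to an estimate on a short interval, with h
  built from the norms of the derivatives involved.\<close>

lemma has_ac_deriv_if_small_increments:
  assumes v: "v absolutely_integrable_on {a..b}" and h: "h absolutely_integrable_on {a..b}"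
    and small: "\<And>e. e > 0 \<Longrightarrow> \<exists>d>0. \<forall>x y. a \<le> x \<longrightarrow> x \<le> y \<longrightarrow> y \<le> b \<longrightarrow> y - x < d \<longrightarrow>
      norm (U y - U x - integral {x..y} v) \<le> e * integral {x..y} h"
  shows "has_ac_deriv a b U v"
proof -
  have comb: "integral {a..y} k - integral {a..x} k = integral {x..y} k"
    if "k absolutely_integrable_on {a..b}" "a \<le> x" "x \<le> y" "y \<le> b"
    for k :: "real \<Rightarrow> 'b::euclidean_space" and x y
  proof -
    have "k integrable_on {a..y}"
      by (rule integrable_on_subinterval[where S = "{a..b}"])
        (use that set_lebesgue_integral_eq_integral(1)[OF that(1)] in auto)
    then have "integral {a..x} k + integral {x..y} k = integral {a..y} k"
      using that by (intro Henstock_Kurzweil_Integration.integral_combine) auto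
    then show ?thesis by (simp add: algebra_simps)
  qed
  have *: "U x - integral {a..x} v = U a - integral {a..a} v" if "x \<in> {a..b}" for x
  proof (rule constant_if_small_increments[where F = "\<lambda>x. U x - integral {a..x} v"
        and G = "\<lambda>x. integral {a..x} h", OF _ that])
    fix e :: real assume "e > 0"
    then obtain d where "d > 0" and d: "\<And>x y. a \<le> x \<Longrightarrow> x \<le> y \<Longrightarrow> y \<le> b \<Longrightarrow> y - x < d \<Longrightarrow>
      norm (U y - U x - integral {x..y} v) \<le> e * integral {x..y} h"
      using small by blast
    have "norm (U y - integral {a..y} v - (U x - integral {a..x} v))
          \<le> e * (integral {a..y} h - integral {a..x} h)"
      if xy: "a \<le> x" "x \<le> y" "y \<le> b" "y - x < d" for x y
    proof -
      have "U y - integral {a..y} v - (U x - integral {a..x} v) =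
         U y - U x - (integral {a..y} v - integral {a..x} v)"
        by (simp add: algebra_simps)
      then show ?thesis
        using d[OF xy] xy by (simp only: comb[OF v] comb[OF h])
    qed
    then show "\<exists>d>0. \<forall>x y. a \<le> x \<longrightarrow> x \<le> y \<longrightarrow> y \<le> b \<longrightarrow> y - x < d \<longrightarrow>
       norm (U y - integral {a..y} v - (U x - integral {a..x} v))
       \<le> e * (integral {a..y} h - integral {a..x} h)"
      using \<open>d > 0\<close> by blast
  qed
  show ?thesis
  proof (rule has_ac_derivI[OF v])
    fix x assume "x \<in> {a..b}"
    then show "U x = U a + integral {a..x} v"
      using *[of x] by (simp only: diff_eq_eq) simp
  qed
qed

lemma absolutely_integrable_subintervalD:
  fixes v :: "real \<Rightarrow> 'b::euclidean_space"
  assumes "v absolutely_integrable_on {a..b}" "a \<le> x" "y \<le> b"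
  shows "v absolutely_integrable_on {x..y}" "v integrable_on {x..y}"
    "(\<lambda>t. norm (v t)) integrable_on {x..y}"
proof -
  show "v absolutely_integrable_on {x..y}"
    using assms by (intro absolutely_integrable_on_subinterval[OF assms(1)]) auto
  then show "v integrable_on {x..y}" "(\<lambda>t. norm (v t)) integrable_on {x..y}"
    by (auto simp: absolutely_integrable_on_def)
qed

lemma norm_integral_mult_le:
  fixes g v :: "real \<Rightarrow> complex"
  assumes "continuous_on {x..y} g" "v absolutely_integrable_on {x..y}"
    and "\<And>t. t \<in> {x..y} \<Longrightarrow> norm (g t) \<le> e"
  shows "norm (integral {x..y} (\<lambda>t. g t * v t)) \<le> e * integral {x..y} (\<lambda>t. norm (v t))"
proof -
  have "norm (integral {x..y} (\<lambda>t. g t * v t)) \<le> integral {x..y} (\<lambda>t. e * norm (v t))"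
  proof (rule integral_norm_bound_integral)
    show "(\<lambda>t. g t * v t) integrable_on {x..y}"
      by (intro set_lebesgue_integral_eq_integral(1) absolutely_integrable_continuous_mult assms)
    show "(\<lambda>t. e * norm (v t)) integrable_on {x..y}"
      using assms(2) by (intro integrable_on_mult_right) (auto simp: absolutely_integrable_on_def)
  qed (use assms(3) in \<open>auto simp: norm_mult intro: mult_right_mono\<close>)
  then show ?thesis by simp
qed

lemma uniformly_continuous_on_IccE:
  fixes g :: "real \<Rightarrow> complex"
  assumes "continuous_on {a..b} g" "e > 0"
  obtains d where "d > 0"
    "\<And>x y s t. a \<le> x \<Longrightarrow> y \<le> b \<Longrightarrow> y - x < d \<Longrightarrow> s \<in> {x..y} \<Longrightarrow> t \<in> {x..y} \<Longrightarrow> norm (g s - g t) \<le> e"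
proof -
  have "uniformly_continuous_on {a..b} g"
    using assms by (intro compact_uniformly_continuous) auto
  then obtain d where d: "d > 0" "\<And>x y. x \<in> {a..b} \<Longrightarrow> y \<in> {a..b} \<Longrightarrow> dist x y < d \<Longrightarrow> dist (g x) (g y) < e"
    using assms(2) unfolding uniformly_continuous_on_def by metis
  show ?thesis
  proof (rule that[OF d(1)])
    fix x y s t assume "a \<le> x" "y \<le> b" "y - x < d" "s \<in> {x..y}" "t \<in> {x..y}"
    then have "dist (g s) (g t) < e"
      by (intro d(2)) (auto simp: dist_real_def)
    then show "norm (g s - g t) \<le> e" by (simp add: dist_norm)
  qed
qed

text \<open>
  The product and quotient rules compare increments on short intervals, which needs neither
  Fubini nor Lebesgue differentiation: since
  \<open>U(y) W(y) - U(x) W(x) = W(x) (U(y) - U(x)) + U(y) (W(y) - W(x))\<close>, the increment differs from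
  \<open>\<integral> v W + U w\<close> over \<open>{x..y}\<close> by the oscillation of \<open>U\<close> and \<open>W\<close> times \<open>\<integral> |v| + |w|\<close>.
\<close>

lemma has_ac_deriv_mult:
  assumes U: "has_ac_deriv a b U v" and W: "has_ac_deriv a b W w"
  shows "has_ac_deriv a b (\<lambda>x. U x * W x) (\<lambda>x. v x * W x + U x * w x)"
proof -
  note contU = has_ac_deriv_continuous_on[OF U] and contW = has_ac_deriv_continuous_on[OF W]
  have v: "v absolutely_integrable_on {a..b}" and w: "w absolutely_integrable_on {a..b}"
    using U W by (auto dest: has_ac_derivD(1))
  show ?thesis
  proof (rule has_ac_deriv_if_small_increments[where h = "\<lambda>t. norm (v t) + norm (w t)"])
    show "(\<lambda>x. v x * W x + U x * w x) absolutely_integrable_on {a..b}"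
      by (intro set_integral_add absolutely_integrable_continuous_mult v w contU contW)
    show "(\<lambda>t. norm (v t) + norm (w t)) absolutely_integrable_on {a..b}"
      by (intro set_integral_add absolutely_integrable_norm[unfolded o_def] v w)
    fix e :: real assume e: "e > 0"
    obtain d1 where d1: "d1 > 0" "\<And>x y s t. a \<le> x \<Longrightarrow> y \<le> b \<Longrightarrow> y - x < d1 \<Longrightarrow>
       s \<in> {x..y} \<Longrightarrow> t \<in> {x..y} \<Longrightarrow> norm (U s - U t) \<le> e"
      using uniformly_continuous_on_IccE[OF contU e] by metis
    obtain d2 where d2: "d2 > 0" "\<And>x y s t. a \<le> x \<Longrightarrow> y \<le> b \<Longrightarrow> y - x < d2 \<Longrightarrow>
       s \<in> {x..y} \<Longrightarrow> t \<in> {x..y} \<Longrightarrow> norm (W s - W t) \<le> e"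
      using uniformly_continuous_on_IccE[OF contW e] by metis
    show "\<exists>d>0. \<forall>x y. a \<le> x \<longrightarrow> x \<le> y \<longrightarrow> y \<le> b \<longrightarrow> y - x < d \<longrightarrow>
       norm (U y * W y - U x * W x - integral {x..y} (\<lambda>x. v x * W x + U x * w x))
       \<le> e * integral {x..y} (\<lambda>t. norm (v t) + norm (w t))"
    proof (intro exI[of _ "min d1 d2"] conjI allI impI)
      fix x y assume xy: "a \<le> x" "x \<le> y" "y \<le> b" "y - x < min d1 d2"
      note v' = absolutely_integrable_subintervalD[OF v xy(1,3)]
      note w' = absolutely_integrable_subintervalD[OF w xy(1,3)]
      have cU: "continuous_on {x..y} U" and cW: "continuous_on {x..y} W"
        using xy contU contW by (auto intro: continuous_on_subset)
      have iv: "(\<lambda>t. (W t - W x) * v t) integrable_on {x..y}"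
        and iw: "(\<lambda>t. (U t - U y) * w t) integrable_on {x..y}"
        by (intro set_lebesgue_integral_eq_integral(1) absolutely_integrable_continuous_mult
            v'(1) w'(1) continuous_intros cU cW)+
      have "integral {x..y} (\<lambda>t. v t * W t + U t * w t) =
         integral {x..y} (\<lambda>t. ((W t - W x) * v t + (U t - U y) * w t) + (W x * v t + U y * w t))"
        by (simp add: algebra_simps)
      also have "\<dots> = (integral {x..y} (\<lambda>t. (W t - W x) * v t) + integral {x..y} (\<lambda>t. (U t - U y) * w t))
         + (W x * (U y - U x) + U y * (W y - W x))"
        by (simp only: Henstock_Kurzweil_Integration.integral_add[OF integrable_add[OF iv iw]
              integrable_add[OF integrable_on_mult_right[OF v'(2)] integrable_on_mult_right[OF w'(2)]]]
            Henstock_Kurzweil_Integration.integral_add[OF iv iw]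
            Henstock_Kurzweil_Integration.integral_add[OF integrable_on_mult_right[OF v'(2)]
              integrable_on_mult_right[OF w'(2)]] integral_mult_right
            has_ac_deriv_increment[OF U xy(1-3)] has_ac_deriv_increment[OF W xy(1-3)])
      finally have "U y * W y - U x * W x - integral {x..y} (\<lambda>t. v t * W t + U t * w t) =
         - (integral {x..y} (\<lambda>t. (W t - W x) * v t) + integral {x..y} (\<lambda>t. (U t - U y) * w t))"
        by (simp add: algebra_simps)
      then have "norm (U y * W y - U x * W x - integral {x..y} (\<lambda>t. v t * W t + U t * w t))
        \<le> norm (integral {x..y} (\<lambda>t. (W t - W x) * v t)) + norm (integral {x..y} (\<lambda>t. (U t - U y) * w t))"
        by (simp only: norm_minus_cancel norm_triangle_ineq)
      also have "\<dots> \<le> e * integral {x..y} (\<lambda>t. norm (v t)) + e * integral {x..y} (\<lambda>t. norm (w t))"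
        using xy by (intro add_mono norm_integral_mult_le continuous_intros v'(1) w'(1) cU cW
            d1(2)[OF xy(1,3)] d2(2)[OF xy(1,3)]) auto
      also have "\<dots> = e * integral {x..y} (\<lambda>t. norm (v t) + norm (w t))"
        by (simp add: Henstock_Kurzweil_Integration.integral_add[OF v'(3) w'(3)] algebra_simps)
      finally show "norm (U y * W y - U x * W x - integral {x..y} (\<lambda>x. v x * W x + U x * w x))
       \<le> e * integral {x..y} (\<lambda>t. norm (v t) + norm (w t))" .
    qed (use d1(1) d2(1) in auto)
  qed
qed

text \<open>Since 1/U(y) - 1/U(x) = - (U(y) - U(x)) / (U(x) U(y)), the defect over {x..y} is the
  integral of k v with k(t) = 1/U(t)^2 - 1/(U(x) U(y)). Uniform continuity and boundedness of 1/U
  make k small on short intervals.\<close>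

lemma has_ac_deriv_inverse:
  assumes U: "has_ac_deriv a b U v" and nz: "\<And>x. x \<in> {a..b} \<Longrightarrow> U x \<noteq> 0"
  shows "has_ac_deriv a b (\<lambda>x. 1 / U x) (\<lambda>x. - v x / (U x)\<^sup>2)"
proof -
  note contU = has_ac_deriv_continuous_on[OF U]
  have v: "v absolutely_integrable_on {a..b}"
    using U by (rule has_ac_derivD(1))
  have contI: "continuous_on {a..b} (\<lambda>x. 1 / U x)"
    using nz by (intro continuous_intros contU) auto
  have "bounded ((\<lambda>x. 1 / U x) ` {a..b})"
    by (intro compact_imp_bounded compact_continuous_image contI compact_Icc)
  then obtain B where B: "\<And>x. x \<in> {a..b} \<Longrightarrow> norm (1 / U x) \<le> B"
    unfolding bounded_iff by blast
  have aint: "(\<lambda>x. - (1 / U x)\<^sup>2 * v x) absolutely_integrable_on {a..b}"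
    by (intro absolutely_integrable_continuous_mult v continuous_intros contI)
  have eq: "(\<lambda>x. - v x / (U x)\<^sup>2) = (\<lambda>x. - (1 / U x)\<^sup>2 * v x)"
    by (simp add: power_divide)
  show ?thesis
    unfolding eq
  proof (rule has_ac_deriv_if_small_increments[where h = "\<lambda>t. norm (v t)", OF aint])
    show "(\<lambda>t. norm (v t)) absolutely_integrable_on {a..b}"
      by (intro absolutely_integrable_norm[unfolded o_def] v)
    fix e :: real assume e: "e > 0"
    show "\<exists>d>0. \<forall>x y. a \<le> x \<longrightarrow> x \<le> y \<longrightarrow> y \<le> b \<longrightarrow> y - x < d \<longrightarrow>
       norm (1 / U y - 1 / U x - integral {x..y} (\<lambda>x. - (1 / U x)\<^sup>2 * v x))
       \<le> e * integral {x..y} (\<lambda>t. norm (v t))"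
    proof -
      \<comment> \<open>k splits into two products of an oscillation of 1/U and a value of 1/U,
        which gives the factor 2 |B|; the summand 1 keeps the divisor positive.\<close>
      define B' where "B' = 2 * \<bar>B\<bar> + 1"
      obtain d where d: "d > 0" "\<And>x y s t. a \<le> x \<Longrightarrow> y \<le> b \<Longrightarrow> y - x < d \<Longrightarrow>
         s \<in> {x..y} \<Longrightarrow> t \<in> {x..y} \<Longrightarrow> norm (1 / U s - 1 / U t) \<le> e / B'"
        using uniformly_continuous_on_IccE[OF contI, of "e / B'"] e by (auto simp: B'_def)
      have "norm (1 / U y - 1 / U x - integral {x..y} (\<lambda>x. - (1 / U x)\<^sup>2 * v x))
         \<le> e * integral {x..y} (\<lambda>t. norm (v t))"
        if xy: "a \<le> x" "x \<le> y" "y \<le> b" "y - x < d" for x y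
      proof -
        note v' = absolutely_integrable_subintervalD[OF v xy(1,3)]
        note a' = absolutely_integrable_subintervalD[OF aint xy(1,3)]
        have cI: "continuous_on {x..y} (\<lambda>x. 1 / U x)"
          using xy contI by (auto intro: continuous_on_subset)
        define k where "k = (\<lambda>t. (1 / U t)\<^sup>2 - 1 / U x * (1 / U y))"
        have ck: "continuous_on {x..y} k"
          unfolding k_def by (intro continuous_intros cI)
        have bk: "norm (k t) \<le> e" if t: "t \<in> {x..y}" for t
        proof -
          have "k t = (1 / U t - 1 / U x) * (1 / U t) + (1 / U t - 1 / U y) * (1 / U x)"
            by (simp add: k_def algebra_simps power2_eq_square)
          then have "norm (k t) \<le> norm (1 / U t - 1 / U x) * norm (1 / U t) + norm (1 / U t - 1 / U y) * norm (1 / U x)"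
            by (simp only: norm_mult[symmetric] norm_triangle_ineq)
          also have "\<dots> \<le> e / B' * \<bar>B\<bar> + e / B' * \<bar>B\<bar>"
          proof (intro add_mono mult_mono)
            show "norm (1 / U t) \<le> \<bar>B\<bar>" "norm (1 / U x) \<le> \<bar>B\<bar>"
              using B[of t] B[of x] t xy by auto
            show "norm (1 / U t - 1 / U x) \<le> e / B'" "norm (1 / U t - 1 / U y) \<le> e / B'"
              using t xy by (auto intro!: d(2)[OF xy(1,3,4)] simp del: norm_divide)
          qed (use e in \<open>auto simp: B'_def\<close>)
          also have "\<dots> = e * (2 * \<bar>B\<bar> / B')"
            by simp
          also have "\<dots> \<le> e * 1"
            using e by (intro mult_left_mono) (auto simp: B'_def)
          finally show ?thesis by simp
        qed
        have "U x \<noteq> 0" "U y \<noteq> 0"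
          using nz xy by auto
        then have "1 / U y - 1 / U x = - (1 / U x * (1 / U y)) * (U y - U x)"
          by (simp add: divide_simps)
        also have "\<dots> = integral {x..y} (\<lambda>t. - (1 / U x * (1 / U y)) * v t)"
          using v' xy by (simp add: has_ac_deriv_increment[OF U])
        finally have "1 / U y - 1 / U x - integral {x..y} (\<lambda>x. - (1 / U x)\<^sup>2 * v x) =
           integral {x..y} (\<lambda>t. - (1 / U x * (1 / U y)) * v t - (- (1 / U t)\<^sup>2 * v t))"
          by (subst Henstock_Kurzweil_Integration.integral_diff[OF integrable_on_mult_right[OF v'(2)] a'(2)]) simp
        also have "\<dots> = integral {x..y} (\<lambda>t. k t * v t)"
          by (simp add: k_def algebra_simps)
        finally show ?thesis
          using norm_integral_mult_le[OF ck v'(1) bk] by simp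
      qed
      with d(1) show ?thesis by blast
    qed
  qed
qed

section \<open>Bump functions\<close>

text \<open>A smooth function is carried together with all its derivatives. Products and linear
  combinations then act on whole sequences, and an antiderivative is prepended by shifting the
  index.\<close>

definition deriv_seq :: "(nat \<Rightarrow> real \<Rightarrow> complex) \<Rightarrow> bool" where
  "deriv_seq D \<longleftrightarrow> (\<forall>n x. (D n has_vector_derivative D (Suc n) x) (at x))"

text \<open>\<open>leibniz D D' n i j\<close> is the \<open>n\<close>-th derivative of \<open>D i * D' j\<close>.\<close>

primrec leibniz :: "(nat \<Rightarrow> real \<Rightarrow> complex) \<Rightarrow> (nat \<Rightarrow> real \<Rightarrow> complex) \<Rightarrow> nat \<Rightarrow> nat \<Rightarrow> nat \<Rightarrow> real \<Rightarrow> complex" where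
  "leibniz D D' 0 i j = (\<lambda>x. D i x * D' j x)"
| "leibniz D D' (Suc n) i j = (\<lambda>x. leibniz D D' n (Suc i) j x + leibniz D D' n i (Suc j) x)"

lemma deriv_seq_mult:
  assumes "deriv_seq D" "deriv_seq D'"
  shows "deriv_seq (\<lambda>n. leibniz D D' n 0 0)"
proof -
  have "(leibniz D D' n i j has_vector_derivative leibniz D D' (Suc n) i j x) (at x)" for n i j x
  proof (induction n arbitrary: i j)
    case 0
    have "((\<lambda>x. D i x * D' j x) has_vector_derivative (D i x * D' (Suc j) x + D (Suc i) x * D' j x)) (at x)"
      using assms by (intro has_vector_derivative_mult) (auto simp: deriv_seq_def)
    then show ?case by (simp add: add.commute)
  next
    case (Suc n)
    show ?case
      unfolding leibniz.simps(2)[of D D' n i j] leibniz.simps(2)[of D D' "Suc n" i j]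
      by (intro has_vector_derivative_add Suc.IH)
  qed
  then show ?thesis
    unfolding deriv_seq_def by blast
qed

lemma test_functionsI:
  assumes D: "deriv_seq D" and "\<And>x. x \<notin> {c..d} \<Longrightarrow> D 0 x = 0" and "{c..d} \<subseteq> J"
  shows "D 0 \<in> test_functions J"
proof -
  have "closure {x. D 0 x \<noteq> 0} \<subseteq> {c..d}"
    using assms(2) by (intro closure_minimal) (blast, simp)
  then have "compact (closure {x. D 0 x \<noteq> 0})" "closure {x. D 0 x \<noteq> 0} \<subseteq> J"
    using assms(3) by (auto simp: compact_eq_bounded_closed intro: bounded_subset[of "{c..d}"])
  then show ?thesis
    using D by (auto simp: test_functions_def deriv_seq_def)
qed

lemma test_functionsE:
  assumes "\<phi> \<in> test_functions {a<..<b}" "a < b"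
  obtains D c d where "D 0 = \<phi>" "deriv_seq D" "a < c" "c < d" "d < b" "\<And>x. x \<notin> {c..d} \<Longrightarrow> \<phi> x = 0"
proof -
  obtain D where D: "D 0 = \<phi>" "deriv_seq D"
    using assms(1) by (auto simp: test_functions_def deriv_seq_def)
  define K where "K = closure {x. \<phi> x \<noteq> 0}"
  have K: "compact K" "K \<subseteq> {a<..<b}" "\<And>x. x \<notin> K \<Longrightarrow> \<phi> x = 0"
    using assms(1) closure_subset[of "{x. \<phi> x \<noteq> 0}"] by (auto simp: test_functions_def K_def)
  show ?thesis
  proof (cases "K = {}")
    case True
    then show ?thesis
      using K D assms(2) by (intro that[of D "a + (b - a) / 3" "a + (b - a) / 2"]) (auto simp: field_simps)
  next
    case False
    obtain l u where lu: "l \<in> K" "u \<in> K" "\<And>x. x \<in> K \<Longrightarrow> l \<le> x \<and> x \<le> u"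
      using compact_attains_inf[OF K(1) False] compact_attains_sup[OF K(1) False] by metis
    then have "a < l" "u < b" "l \<le> u" using K by auto
    \<comment> \<open>Midpoints leave room on both sides of the support: the interval stays inside
      {a<..<b} and is nondegenerate even if l = u.\<close>
    then show ?thesis
    proof (intro that[of D "(a + l) / 2" "(u + b) / 2"])
      fix x assume "x \<notin> {(a + l) / 2..(u + b) / 2}"
      then have "x \<notin> K"
        using lu(3)[of x] \<open>a < l\<close> \<open>u < b\<close> by auto
      then show "\<phi> x = 0" by (rule K(3))
    qed (use D in auto)
  qed
qed

section \<open>Flat functions built from exp (-1/x)\<close>

lemma poly_div_exp_tendsto_0: "((\<lambda>t::real. poly p t * exp (- t)) \<longlongrightarrow> 0) at_top"
proof -
  have "((\<lambda>t::real. \<Sum>i\<le>degree p. coeff p i * (t ^ i / exp t)) \<longlongrightarrow> (\<Sum>i\<le>degree p. coeff p i * 0)) at_top"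
    by (intro tendsto_intros tendsto_power_div_exp_0)
  then show ?thesis
    by (simp add: poly_altdef sum_divide_distrib exp_minus divide_inverse sum_distrib_right mult.assoc)
qed

text \<open>The classical flat function exp(-1/x), extended by 0 to x \<le> 0, with a polynomial in
  1/x as factor. This family is closed under differentiation, so one derivative rule yields
  smoothness.\<close>

definition exp_inv_poly :: "real poly \<Rightarrow> real \<Rightarrow> real" where
  "exp_inv_poly p x = (if x \<le> 0 then 0 else poly p (inverse x) * exp (- inverse x))"

lemma exp_inv_poly_tendsto_0: "(exp_inv_poly p \<longlongrightarrow> 0) (at 0)"
proof -
  have "((\<lambda>x. poly p (inverse x) * exp (- inverse x)) \<longlongrightarrow> 0) (at_right (0::real))"
    by (rule filterlim_compose[OF poly_div_exp_tendsto_0 filterlim_inverse_at_top_right])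
  moreover have "\<forall>\<^sub>F x in at_right (0::real). poly p (inverse x) * exp (- inverse x) = exp_inv_poly p x"
    by (auto simp: eventually_at_filter exp_inv_poly_def)
  ultimately have "(exp_inv_poly p \<longlongrightarrow> 0) (at_right 0)"
    by (rule Lim_transform_eventually)
  moreover have "(exp_inv_poly p \<longlongrightarrow> 0) (at_left 0)"
    by (rule Lim_transform_eventually[OF tendsto_const]) (auto simp: eventually_at_filter exp_inv_poly_def)
  ultimately show ?thesis
    by (simp add: filterlim_split_at)
qed

text \<open>With t = 1/x, differentiating p(t) exp(-t) with respect to x gives t^2 (p(t) - p'(t))
  exp(-t); \<open>[:0, 0, 1:]\<close> is the factor t^2.\<close>

definition exp_inv_step :: "real poly \<Rightarrow> real poly" where
  "exp_inv_step p = [:0, 0, 1:] * (p - pderiv p)"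

lemma exp_inv_poly_has_derivative:
  "(exp_inv_poly p has_real_derivative exp_inv_poly (exp_inv_step p) x) (at x)"
proof -
  consider "x < 0" | "x = 0" | "x > 0" by linarith
  then show ?thesis
  proof cases
    case 1
    have "((\<lambda>_. 0) has_real_derivative 0) (at x)" by simp
    then have "(exp_inv_poly p has_real_derivative 0) (at x)"
      by (rule has_field_derivative_transform_within_open[where S = "{..<0}"])
        (use 1 in \<open>auto simp: exp_inv_poly_def\<close>)
    then show ?thesis using 1 by (simp add: exp_inv_poly_def)
  next
    case 2
    \<comment> \<open>Dividing by h multiplies the polynomial in 1/h by its variable, so the
      difference quotient at 0 is again a member of the family and tends to 0.\<close>
    have "((\<lambda>h. (exp_inv_poly p (0 + h) - exp_inv_poly p 0) / h) \<longlongrightarrow> 0) (at 0)"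
      by (rule Lim_transform_eventually[OF exp_inv_poly_tendsto_0[of "[:0, 1:] * p"]])
        (auto simp: eventually_at_filter exp_inv_poly_def field_simps)
    then show ?thesis using 2
      unfolding DERIV_def by (simp add: exp_inv_poly_def[of "exp_inv_step p"])
  next
    case 3
    have "((\<lambda>x. poly p (inverse x) * exp (- inverse x)) has_real_derivative
        poly (exp_inv_step p) (inverse x) * exp (- inverse x)) (at x)"
      using 3 unfolding exp_inv_step_def
      by (auto intro!: derivative_eq_intros DERIV_chain2[OF poly_DERIV] simp: algebra_simps power2_eq_square)
    then have "(exp_inv_poly p has_real_derivative poly (exp_inv_step p) (inverse x) * exp (- inverse x)) (at x)"
      by (rule has_field_derivative_transform_within_open[where S = "{0<..}"])
        (use 3 in \<open>auto simp: exp_inv_poly_def\<close>)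
    then show ?thesis using 3 by (simp add: exp_inv_poly_def)
  qed
qed

text \<open>All derivatives of exp(-1/(s (x - c))), with \<open>s ^ n\<close> from the chain rule.
  Positive s gives a function living to the right of c, negative s one living to the left.\<close>

definition exp_inv_seq :: "real \<Rightarrow> real \<Rightarrow> nat \<Rightarrow> real \<Rightarrow> complex" where
  "exp_inv_seq s c n x = of_real (s ^ n * exp_inv_poly ((exp_inv_step ^^ n) 1) (s * (x - c)))"

lemma deriv_seq_exp_inv_seq: "deriv_seq (exp_inv_seq s c)"
  unfolding deriv_seq_def
proof (intro allI)
  fix n x
  have "((\<lambda>x. exp_inv_poly p (s * (x - c))) has_real_derivative exp_inv_poly (exp_inv_step p) (s * (x - c)) * s) (at x)" for p
    by (rule DERIV_chain2[OF exp_inv_poly_has_derivative]) (auto intro!: derivative_eq_intros)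
  then have "((\<lambda>x. s ^ n * exp_inv_poly ((exp_inv_step ^^ n) 1) (s * (x - c))) has_real_derivative
      s ^ Suc n * exp_inv_poly ((exp_inv_step ^^ Suc n) 1) (s * (x - c))) (at x)"
    by (auto intro!: derivative_eq_intros)
  then show "(exp_inv_seq s c n has_vector_derivative exp_inv_seq s c (Suc n) x) (at x)"
    unfolding exp_inv_seq_def
    by (intro has_vector_derivative_of_real) (simp add: has_real_derivative_iff_has_vector_derivative)
qed

text \<open>
  The exponent \<open>-1/(n + 1) (1/(x - c) + 1/(d - x))\<close> makes these test functions increase to the
  indicator function of \<open>{c<..<d}\<close>.
\<close>

definition bump :: "real \<Rightarrow> real \<Rightarrow> nat \<Rightarrow> real \<Rightarrow> complex" where
  "bump c d n x = exp_inv_seq (real (Suc n)) c 0 x * exp_inv_seq (- real (Suc n)) d 0 x"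

lemma bump_eq:
  "bump c d n x = (if x \<in> {c<..<d} then
     of_real (exp (- inverse (real (Suc n) * (x - c))) * exp (- inverse (real (Suc n) * (d - x)))) else 0)"
proof -
  have "- real (Suc n) * (x - d) = real (Suc n) * (d - x)"
    by (simp add: algebra_simps)
  moreover have "real (Suc n) * k \<le> 0 \<longleftrightarrow> k \<le> 0" for k
    by (simp add: mult_le_0_iff)
  ultimately show ?thesis
    unfolding bump_def exp_inv_seq_def exp_inv_poly_def by auto
qed

lemma bump_test_function:
  assumes "{c..d} \<subseteq> J"
  shows "bump c d n \<in> test_functions J"
proof -
  have "leibniz (exp_inv_seq (real (Suc n)) c) (exp_inv_seq (- real (Suc n)) d) 0 0 0 \<in> test_functions J"
  proof (rule test_functionsI[where c = c and d = d and D =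
        "\<lambda>k. leibniz (exp_inv_seq (real (Suc n)) c) (exp_inv_seq (- real (Suc n)) d) k 0 0"])
    fix x assume "x \<notin> {c..d}"
    then show "leibniz (exp_inv_seq (real (Suc n)) c) (exp_inv_seq (- real (Suc n)) d) 0 0 0 x = 0"
      using bump_eq[of c d n x] by (auto simp: bump_def)
  qed (intro deriv_seq_mult deriv_seq_exp_inv_seq assms)+
  then show ?thesis by (simp add: bump_def[abs_def])
qed

lemma norm_bump_le: "norm (bump c d n x) \<le> 1"
proof (cases "x \<in> {c<..<d}")
  case True
  then have "exp (- inverse (real (Suc n) * (x - c))) * exp (- inverse (real (Suc n) * (d - x))) \<le> 1 * 1"
    by (intro mult_mono) auto
  then show ?thesis using True by (simp add: bump_eq norm_mult)
qed (auto simp: bump_eq)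

lemma bump_tendsto: "(\<lambda>n. bump c d n x) \<longlonglongrightarrow> indicator {c<..<d} x"
proof (cases "x \<in> {c<..<d}")
  case True
  have *: "(\<lambda>n. inverse (real (Suc n) * k)) \<longlonglongrightarrow> 0" for k
    using tendsto_mult_right[OF LIMSEQ_inverse_real_of_nat, of "inverse k"] by simp
  have "(\<lambda>n. of_real (exp (- inverse (real (Suc n) * (x - c))) * exp (- inverse (real (Suc n) * (d - x))))) \<longlonglongrightarrow>
      (of_real (exp (- 0) * exp (- 0)) :: complex)"
    by (intro tendsto_intros *)
  then show ?thesis using True by (simp add: bump_eq)
qed (auto simp: bump_eq)

lemma continuous_on_bump: "continuous_on S (bump c d n)"
proof -
  have "continuous_on S (exp_inv_seq s c 0)" for s c
    using deriv_seq_exp_inv_seq[of s c] unfolding deriv_seq_def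
    by (meson continuous_at_imp_continuous_on has_vector_derivative_continuous)
  then show ?thesis
    unfolding bump_def by (intro continuous_intros)
qed

section \<open>The fundamental lemma and the lemma of du Bois-Reymond\<close>

lemma deriv_seq_continuous_on: "deriv_seq D \<Longrightarrow> continuous_on S (D n)"
  unfolding deriv_seq_def
  by (meson continuous_at_imp_continuous_on has_vector_derivative_continuous)

lemma locally_integrable_mult:
  fixes u \<phi> :: "real \<Rightarrow> complex"
  assumes u: "locally_integrable {a<..<b} u" and c: "continuous_on UNIV \<phi>"
    and cd: "a < c" "d < b" and 0: "\<And>x. x \<notin> {c..d} \<Longrightarrow> \<phi> x = 0"
  shows "integrable (lebesgue_on {a<..<b}) (\<lambda>x. u x * \<phi> x)"
proof -
  have "u absolutely_integrable_on {c..d}"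
    using u cd unfolding locally_integrable_def by (auto simp: subset_eq)
  then have "(\<lambda>x. u x * \<phi> x) absolutely_integrable_on {c..d}"
    by (intro absolutely_integrable_continuous_mult continuous_on_subset[OF c]) auto
  then have "integrable lebesgue (\<lambda>x. indicator {c..d} x *\<^sub>R (u x * \<phi> x))"
    by (simp add: set_integrable_def)
  also have "(\<lambda>x. indicator {c..d} x *\<^sub>R (u x * \<phi> x)) = (\<lambda>x. indicator {a<..<b} x *\<^sub>R (u x * \<phi> x))"
    using 0 cd by (auto simp: indicator_def fun_eq_iff)
  finally show ?thesis
    by (simp add: integrable_restrict_space)
qed

text \<open>Completion does not change the measure of Borel sets, so a countable cover for
  \<open>lborel\<close> still serves. Sigma-finiteness is what \<open>density_zero\<close> asks
  for.\<close>

lemma sigma_finite_lebesgue: "sigma_finite_measure (lebesgue :: 'a::euclidean_space measure)"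
proof
  obtain A :: "'a set set" where A: "countable A" "A \<subseteq> sets lborel" "\<Union>A = space lborel"
      "\<forall>a\<in>A. emeasure lborel a \<noteq> \<infinity>"
    using lborel.sigma_finite_countable by metis
  show "\<exists>A::'a set set. countable A \<and> A \<subseteq> sets lebesgue \<and> \<Union>A = space lebesgue \<and> (\<forall>a\<in>A. emeasure lebesgue a \<noteq> \<infinity>)"
  proof (intro exI[of _ A] conjI ballI)
    show "A \<subseteq> sets lebesgue" using A(2) by (auto intro: sets_completionI_sets)
    show "\<Union>A = space lebesgue" using A(3) by simp
    fix X assume "X \<in> A"
    then have "X \<in> sets lborel" "emeasure lborel X \<noteq> \<infinity>" using A(2,4) by auto
    then show "emeasure lebesgue X \<noteq> \<infinity>" by simp
  qed (rule A(1))
qed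

text \<open>Open intervals form an intersection-stable generator of the Borel sets, and sets over
  which f integrates to 0 are closed under disjoint countable unions and, by \<open>z'\<close>,
  under complements. A function with vanishing integral over every measurable set is zero almost
  everywhere.\<close>

lemma AE_zero_if_interval_integrals_zero:
  fixes f :: "real \<Rightarrow> complex"
  assumes f: "integrable lebesgue f"
    and z: "\<And>p q. (LINT x|lebesgue. indicator {p<..<q} x *\<^sub>R f x) = 0"
    and z': "(LINT x|lebesgue. f x) = 0"
  shows "AE x in lebesgue. f x = 0"
proof (rule sigma_finite_measure.density_zero[OF sigma_finite_lebesgue f])
  have borel: "(LINT x|lebesgue. indicator A x *\<^sub>R f x) = 0" if "A \<in> sets borel" for A
  proof -
    have int: "integrable lebesgue (\<lambda>x. indicator A x *\<^sub>R f x)" if "A \<in> sets borel" for A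
      using that f by (intro integrable_mult_indicator) (auto simp: sets_completionI_sets)
    let ?G = "range (\<lambda>(p, q). {p<..<q::real})"
    have sets: "sets borel = sigma_sets UNIV ?G"
    proof -
      have "(\<lambda>(p, q). box p q) = (\<lambda>(p, q). {p<..<q::real})" by (auto simp: fun_eq_iff)
      then have "borel = sigma UNIV ?G" using borel_eq_box[where 'a = real] by simp
      then have "sets borel = sets (sigma UNIV ?G)" by (rule arg_cong)
      also have "\<dots> = sigma_sets UNIV ?G" by (rule sets_measure_of) simp
      finally show ?thesis .
    qed
    have stable: "Int_stable ?G"
    proof (rule Int_stableI)
      fix X Y :: "real set" assume "X \<in> ?G" "Y \<in> ?G"
      then obtain p q r s where "X = {p<..<q}" "Y = {r<..<s}" by auto
      then have "X \<inter> Y = {max p r<..<min q s}" by auto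
      then show "X \<inter> Y \<in> ?G" by auto
    qed
    have Pow: "?G \<subseteq> Pow UNIV" by simp
    have A: "A \<in> sigma_sets UNIV ?G" using that sets by simp
    from stable Pow A show ?thesis
    proof (induction rule: sigma_sets_induct_disjoint)
      case (basic A)
      then show ?case using z by auto
    next
      case (compl A)
      have "(\<lambda>x. indicator (UNIV - A) x *\<^sub>R f x) = (\<lambda>x. f x - indicator A x *\<^sub>R f x)"
        by (auto simp: indicator_def)
      then show ?case
        using compl z' f int[of A] sets by (simp add: Bochner_Integration.integral_diff)
    next
      case (union A)
      then have A: "\<And>i. A i \<in> sets borel" using sets by auto
      have "(LINT x:(\<Union>i. A i)|lebesgue. f x) = (\<Sum>i. LINT x:A i|lebesgue. f x)"
      proof (rule lebesgue_integral_countable_add)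
        show "set_integrable lebesgue (\<Union>i. A i) f"
          unfolding set_integrable_def using A by (intro int) auto
      qed (use A union.hyps(1) in \<open>auto simp: disjoint_family_on_def sets_completionI_sets\<close>)
      then show ?case
        using union.IH by (simp add: set_lebesgue_integral_def)
    qed auto
  qed
  fix A :: "real set" assume A: "A \<in> sets lebesgue"
  \<comment> \<open>A Lebesgue set differs from its Borel main part by a null set, which the
    integral ignores.\<close>
  have "AE x in lebesgue. x \<in> main_part lborel A \<longleftrightarrow> x \<in> A"
    using AE_in_main_part[of A lborel] A by (intro AE_completion) auto
  then have "(LINT x|lebesgue. indicator A x *\<^sub>R f x) = (LINT x|lebesgue. indicator (main_part lborel A) x *\<^sub>R f x)"
    using A f main_part_sets[of A lborel]
    by (intro integral_cong_AE borel_measurable_scaleR borel_measurable_indicator)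
      (auto simp: indicator_def sets_completionI_sets)
  then show "set_lebesgue_integral lebesgue A f = 0"
    using borel[of "main_part lborel A"] main_part_sets[of A lborel] A
    by (simp add: set_lebesgue_integral_def)
qed

text \<open>Bumps converge to indicators of open intervals and are bounded by 1, so dominated
  convergence turns the hypothesis into vanishing integrals over intervals. Local integrability
  gives a dominating function only on compact parts of J, whence the exhaustion by {a + 1/(n+1)..b -
  1/(n+1)}.\<close>

lemma fundamental_lemma:
  assumes v: "locally_integrable {a<..<b} v"
    and z: "\<And>\<phi>. \<phi> \<in> test_functions {a<..<b} \<Longrightarrow> (LINT x|lebesgue_on {a<..<b}. v x * \<phi> x) = 0"
  shows "AE x in lebesgue_on {a<..<b}. v x = 0"
proof -
  have loc: "AE x in lebesgue. x \<in> {c..d} \<longrightarrow> v x = 0" if cd: "a < c" "d < b" for c d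
  proof -
    define w where "w = (\<lambda>x. indicator {c..d} x *\<^sub>R v x)"
    have "v absolutely_integrable_on {c..d}"
      using v cd unfolding locally_integrable_def by (auto simp: subset_eq)
    then have w: "integrable lebesgue w"
      by (simp add: set_integrable_def w_def)
    have open_int: "(LINT x|lebesgue. indicator {p<..<q} x *\<^sub>R w x) = 0" if pq: "c \<le> p" "q \<le> d" for p q
    proof -
      have "(\<lambda>n. LINT x|lebesgue. bump p q n x * w x) \<longlonglongrightarrow> (LINT x|lebesgue. indicator {p<..<q} x * w x)"
      proof (rule integral_dominated_convergence[where w = "\<lambda>x. norm (w x)"])
        show "(\<lambda>x. bump p q n x * w x) \<in> borel_measurable lebesgue" for n
          using w by (intro borel_measurable_times)
            (auto intro!: measurable_completion borel_measurable_continuous_onI continuous_on_bump)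
        show "(\<lambda>x. indicator {p<..<q} x * w x) \<in> borel_measurable lebesgue"
          using w by (intro borel_measurable_times borel_measurable_indicator) auto
        show "AE x in lebesgue. (\<lambda>n. bump p q n x * w x) \<longlonglongrightarrow> indicator {p<..<q} x * w x"
          by (intro AE_I2 tendsto_intros bump_tendsto)
        show "AE x in lebesgue. norm (bump p q n x * w x) \<le> norm (w x)" for n
          using norm_bump_le by (auto simp: norm_mult mult_left_le_one_le)
      qed (use w in simp)
      moreover have "(LINT x|lebesgue. bump p q n x * w x) = 0" for n
      proof -
        have "(LINT x|lebesgue. bump p q n x * w x) = (LINT x|lebesgue. indicator {a<..<b} x *\<^sub>R (v x * bump p q n x))"
          using cd pq by (intro Bochner_Integration.integral_cong) (auto simp: w_def bump_eq indicator_def)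
        also have "\<dots> = (LINT x|lebesgue_on {a<..<b}. v x * bump p q n x)"
          by (simp add: integral_restrict_space)
        also have "\<dots> = 0"
          using cd pq by (intro z bump_test_function) auto
        finally show ?thesis .
      qed
      ultimately have "(LINT x|lebesgue. indicator {p<..<q} x * w x) = 0"
        by (simp add: LIMSEQ_const_iff)
      moreover have "(\<lambda>x. indicator {p<..<q} x * w x) = (\<lambda>x. indicator {p<..<q} x *\<^sub>R w x)"
        by (auto simp: indicator_def)
      ultimately show ?thesis by simp
    qed
    have ae: "AE x in lebesgue. x \<noteq> c \<and> x \<noteq> d"
      by (intro AE_completion AE_conjI AE_lborel_singleton)
    have "AE x in lebesgue. w x = 0"
    proof (rule AE_zero_if_interval_integrals_zero[OF w])
      show "(LINT x|lebesgue. indicator {p<..<q} x *\<^sub>R w x) = 0" for p q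
      proof -
        \<comment> \<open>Clipping to {c<..<d} loses at most the two endpoints, because w vanishes
          outside {c..d}.\<close>
        have "(LINT x|lebesgue. indicator {p<..<q} x *\<^sub>R w x) =
          (LINT x|lebesgue. indicator {max p c<..<min q d} x *\<^sub>R w x)"
        proof (intro integral_cong_AE borel_measurable_scaleR borel_measurable_indicator)
          show "AE x in lebesgue. indicator {p<..<q} x *\<^sub>R w x = indicator {max p c<..<min q d} x *\<^sub>R w x"
            using ae by eventually_elim (auto simp: w_def indicator_def)
        qed (use w in auto)
        then show ?thesis using open_int[of "max p c" "min q d"] by simp
      qed
      have "(LINT x|lebesgue. w x) = (LINT x|lebesgue. indicator {c<..<d} x *\<^sub>R w x)"
      proof (intro integral_cong_AE borel_measurable_scaleR borel_measurable_indicator)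
        show "AE x in lebesgue. w x = indicator {c<..<d} x *\<^sub>R w x"
          using ae by eventually_elim (auto simp: w_def indicator_def)
      qed (use w in auto)
      then show "(LINT x|lebesgue. w x) = 0" using open_int[of c d] by simp
    qed
    then show ?thesis
      by eventually_elim (auto simp: w_def)
  qed
  have "AE x in lebesgue. \<forall>n::nat. x \<in> {a + inverse (Suc n)..b - inverse (Suc n)} \<longrightarrow> v x = 0"
    unfolding AE_all_countable by (intro allI loc) auto
  then have "AE x in lebesgue. x \<in> {a<..<b} \<longrightarrow> v x = 0"
  proof eventually_elim
    case (elim x)
    show ?case
    proof
      assume x: "x \<in> {a<..<b}"
      obtain n :: nat where n: "inverse (Suc n) < min (x - a) (b - x)"
        using reals_Archimedean[of "min (x - a) (b - x)"] x by auto
      then show "v x = 0" using elim[rule_format, of n] by auto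
    qed
  qed
  then show ?thesis
    by (simp add: AE_restrict_space_iff)
qed

lemma deriv_seq_diff_cmult:
  assumes "deriv_seq D" "deriv_seq D'"
  shows "deriv_seq (\<lambda>n x. D n x - k * D' n x)"
  using assms unfolding deriv_seq_def by (auto intro!: derivative_eq_intros)

lemma vector_derivative_deriv_seq: "deriv_seq D \<Longrightarrow> vector_derivative (D n) (at x) = D (Suc n) x"
  unfolding deriv_seq_def by (blast intro: vector_derivative_at)

text \<open>The antiderivative normalised to vanish at c is constant on either side of {c..d}; the
  vanishing integral makes it 0 at d, hence compactly supported.\<close>

lemma deriv_seq_antiderivative:
  assumes D: "deriv_seq D" and 0: "\<And>x. x \<notin> {c..d} \<Longrightarrow> D 0 x = 0" and cd: "c \<le> d"
    and int: "integral {c..d} (D 0) = 0"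
  obtains F where "deriv_seq (case_nat F D)" "\<And>x. x \<notin> {c..d} \<Longrightarrow> F x = 0"
proof -
  have "isCont (D 0) x" for x
    using D unfolding deriv_seq_def by (blast intro: has_vector_derivative_continuous)
  then obtain G where G: "\<And>x. (G has_vector_derivative D 0 x) (at x)"
    using einterval_antiderivative[of "-\<infinity>" \<infinity> "D 0"] by auto
  define F where "F = (\<lambda>x. G x - G c)"
  have F: "(F has_vector_derivative D 0 x) (at x)" for x
    unfolding F_def using G[of x] by (auto intro!: derivative_eq_intros)
  have Fc: "F c = 0" by (simp add: F_def)
  have inc: "integral {x..y} (D 0) = F y - F x" if "x \<le> y" for x y
    using fundamental_theorem_of_calculus[OF that has_vector_derivative_at_within[OF F]]
    by (rule integral_unique)
  have Fd: "F d = 0"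
    using inc[OF cd] int Fc by simp
  have out: "F y = F x" if "x \<le> y" "y \<le> c \<or> d \<le> x" for x y
  proof -
    \<comment> \<open>\<open>D 0\<close> is assumed to vanish only off the closed interval, so c and
      d are discarded as a negligible set.\<close>
    have "integral {x..y} (D 0) = integral {x..y} (\<lambda>_. 0)"
      using that 0 by (intro integral_spike[of "{c, d}"]) auto
    then show ?thesis using inc[OF that(1)] by simp
  qed
  show ?thesis
  proof (rule that[of F])
    show "deriv_seq (case_nat F D)"
      using D F unfolding deriv_seq_def by (auto split: nat.splits)
    show "F x = 0" if "x \<notin> {c..d}" for x
    proof (cases "x < c")
      case True
      then show ?thesis using out[of x c] Fc by simp
    next
      case False
      then have "d < x" using that by simp
      then show ?thesis using out[of d x] Fd by simp
    qed
  qed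
qed

lemma integral_lebesgue_on_support:
  fixes g :: "real \<Rightarrow> complex"
  assumes "continuous_on UNIV g" "\<And>x. x \<notin> {c..d} \<Longrightarrow> g x = 0" "{c..d} \<subseteq> S" "S \<in> sets lebesgue"
  shows "(LINT x|lebesgue_on S. g x) = integral {c..d} g"
proof -
  have "(LINT x|lebesgue_on S. g x) = (LINT x|lebesgue. indicator S x *\<^sub>R g x)"
    using assms(4) by (simp add: integral_restrict_space)
  also have "(\<lambda>x. indicator S x *\<^sub>R g x) = (\<lambda>x. indicator {c..d} x *\<^sub>R g x)"
    using assms by (auto simp: indicator_def fun_eq_iff)
  also have "(LINT x|lebesgue. indicator {c..d} x *\<^sub>R g x) = integral {c..d} g"
    using set_lebesgue_integral_eq_integral(2)[OF absolutely_integrable_continuous_real[of c d g]]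
      continuous_on_subset[OF assms(1)] by (simp add: set_lebesgue_integral_def)
  finally show ?thesis .
qed

text \<open>The real part is continuous and nonnegative; a zero integral would make it vanish
  identically, but it is positive at the midpoint.\<close>

lemma integral_bump_nonzero:
  assumes "c < d"
  shows "integral {c..d} (bump c d n) \<noteq> 0"
proof
  assume z: "integral {c..d} (bump c d n) = 0"
  have int: "bump c d n integrable_on {c..d}"
    by (intro integrable_continuous_real continuous_on_bump)
  have "integral {c..d} (\<lambda>x. Re (bump c d n x)) = 0"
    using integral_linear[OF int bounded_linear_Re] z by (simp add: o_def)
  moreover have "continuous_on {c..d} (\<lambda>x. Re (bump c d n x))"
    by (intro continuous_intros continuous_on_bump)
  moreover have "Re (bump c d n x) \<ge> 0" for x
    by (simp add: bump_eq)
  ultimately have "Re (bump c d n ((c + d) / 2)) = 0"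
    using assms integrable_continuous_real[of c d "\<lambda>x. Re (bump c d n x)"]
    by (intro has_integral_0_cbox_imp_0[of c d "\<lambda>x. Re (bump c d n x)"])
      (auto simp: has_integral_integrable_integral)
  then show False
    using assms by (simp add: bump_eq field_simps)
qed

text \<open>
  With \<open>\<integral> \<rho> = R \<noteq> 0\<close>, every test function \<open>\<psi>\<close> differs from \<open>(\<integral> \<psi> / R) \<rho>\<close> by the derivative of a
  test function.
\<close>

lemma du_Bois_Reymond:
  assumes ab: "a < b" and u: "locally_integrable {a<..<b} u"
    and z: "\<And>\<phi>. \<phi> \<in> test_functions {a<..<b} \<Longrightarrow> (LINT x|lebesgue_on {a<..<b}. u x * vector_derivative \<phi> (at x)) = 0"
  shows "\<exists>k. AE x in lebesgue_on {a<..<b}. u x = k"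
proof -
  let ?M = "lebesgue_on {a<..<b}"
  define p q where "p = a + (b - a) / 3" and "q = a + (b - a) / 2"
  have pq: "a < p" "p < q" "q < b"
    using ab by (auto simp: p_def q_def field_simps)
  define \<rho> where "\<rho> = bump p q 0"
  define R where "R = integral {p..q} \<rho>"
  have R: "R \<noteq> 0"
    using integral_bump_nonzero[OF pq(2)] by (simp add: R_def \<rho>_def)
  \<comment> \<open>If u is constant, testing against \<rho> forces this value.\<close>
  define k where "k = (LINT x|?M. u x * \<rho> x) / R"
  have \<rho>0: "\<rho> x = 0" if "x \<notin> {p..q}" for x
    using that by (auto simp: \<rho>_def bump_eq)
  have \<rho>c: "continuous_on UNIV \<rho>"
    by (simp add: \<rho>_def continuous_on_bump)
  have "\<rho> \<in> test_functions {a<..<b}"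
    using pq unfolding \<rho>_def by (intro bump_test_function) auto
  then obtain E where E: "E 0 = \<rho>" "deriv_seq E"
    using test_functionsE[OF _ ab] by metis
  have "AE x in ?M. u x - k = 0"
  proof (rule fundamental_lemma)
    show li: "locally_integrable {a<..<b} (\<lambda>x. u x - k)"
      using u unfolding locally_integrable_def
      by (auto intro!: set_integral_diff absolutely_integrable_on_const lmeasurable_compact)
    fix \<psi> assume "\<psi> \<in> test_functions {a<..<b}"
    then obtain D c d where D: "D 0 = \<psi>" "deriv_seq D" and cd: "a < c" "c < d" "d < b"
      and \<psi>0: "\<And>x. x \<notin> {c..d} \<Longrightarrow> \<psi> x = 0"
      using test_functionsE[OF _ ab] by metis
    have \<psi>c: "continuous_on UNIV \<psi>"
      using deriv_seq_continuous_on[OF D(2), of _ 0] D(1) by simp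
    define s where "s = integral {c..d} \<psi> / R"
    \<comment> \<open>One compact interval containing the supports of both \<psi> and \<rho>, on
      which \<psi> - s \<rho> has integral 0.\<close>
    define c' d' where "c' = min c p" and "d' = max d q"
    have c'd': "a < c'" "c' \<le> d'" "d' < b" "{c..d} \<subseteq> {c'..d'}" "{p..q} \<subseteq> {c'..d'}"
      using cd pq by (auto simp: c'_def d'_def)
    define X where "X = (\<lambda>n x. D n x - s * E n x)"
    have X: "deriv_seq X"
      unfolding X_def by (intro deriv_seq_diff_cmult D E)
    have X0: "X 0 x = \<psi> x - s * \<rho> x" for x
      by (simp add: X_def D E)
    have X0_zero: "X 0 x = 0" if "x \<notin> {c'..d'}" for x
    proof -
      have "x \<notin> {c..d}" "x \<notin> {p..q}"
        using that c'd'(4,5) by blast+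
      then show ?thesis by (simp add: X0 \<psi>0 \<rho>0)
    qed
    have i1: "integral {c'..d'} \<psi> = integral {c..d} \<psi>"
      by (intro integral_unique has_integral_on_superset[OF integrable_integral _ c'd'(4)]
          integrable_continuous_real continuous_on_subset[OF \<psi>c] \<psi>0) auto
    have i2: "integral {c'..d'} \<rho> = R"
      unfolding R_def
      by (intro integral_unique has_integral_on_superset[OF integrable_integral _ c'd'(5)]
          integrable_continuous_real continuous_on_subset[OF \<rho>c] \<rho>0) auto
    have "integral {c'..d'} (X 0) = integral {c'..d'} \<psi> - s * integral {c'..d'} \<rho>"
      unfolding X0[abs_def]
      by (subst Henstock_Kurzweil_Integration.integral_diff)
        (auto intro!: integrable_continuous_real continuous_intros continuous_on_subset[OF \<psi>c] continuous_on_subset[OF \<rho>c])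
    also have "\<dots> = 0"
      using R by (simp add: i1 i2 s_def)
    finally obtain F where F: "deriv_seq (case_nat F X)" "\<And>x. x \<notin> {c'..d'} \<Longrightarrow> F x = 0"
      using deriv_seq_antiderivative[OF X X0_zero c'd'(2)] by metis
    have "F \<in> test_functions {a<..<b}"
      using test_functionsI[OF F(1), of c' d' "{a<..<b}"] F(2) c'd'(1-3) by force
    moreover have "vector_derivative F (at x) = X 0 x" for x
      using vector_derivative_deriv_seq[OF F(1), of 0 x] by simp
    ultimately have "(LINT x|?M. u x * X 0 x) = 0"
      using z[of F] by simp
    moreover have intu: "integrable ?M (\<lambda>x. u x * \<psi> x)" "integrable ?M (\<lambda>x. u x * \<rho> x)"
      using locally_integrable_mult[OF u \<psi>c cd(1,3) \<psi>0] locally_integrable_mult[OF u \<rho>c pq(1,3) \<rho>0] by auto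
    moreover have "(LINT x|?M. u x * X 0 x) = (LINT x|?M. u x * \<psi> x - s * (u x * \<rho> x))"
      by (simp add: X0 algebra_simps)
    ultimately have *: "(LINT x|?M. u x * \<psi> x) = s * (LINT x|?M. u x * \<rho> x)"
      by (simp add: Bochner_Integration.integral_diff)
    have "locally_integrable {a<..<b} (\<lambda>x. 1)"
      unfolding locally_integrable_def
      by (auto intro!: lmeasurable_compact absolutely_integrable_on_const)
    from locally_integrable_mult[OF this \<psi>c cd(1,3) \<psi>0] have int\<psi>: "integrable ?M \<psi>"
      by simp
    have "(LINT x|?M. (u x - k) * \<psi> x) = (LINT x|?M. u x * \<psi> x) - k * (LINT x|?M. \<psi> x)"
      using intu int\<psi> by (simp add: left_diff_distrib)
    also have "(LINT x|?M. \<psi> x) = s * R"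
      using integral_lebesgue_on_support[OF \<psi>c \<psi>0, where S = "{a<..<b}"] cd R by (auto simp: s_def subset_eq)
    also have "k * (s * R) = s * (LINT x|?M. u x * \<rho> x)"
      using R by (simp add: k_def)
    finally show "(LINT x|?M. (u x - k) * \<psi> x) = 0"
      using * by simp
  qed
  then show ?thesis by auto
qed

section \<open>Weak derivatives and primitives\<close>

text \<open>Bridge between the integral over the open interval, in which the spaces and pairings are
  expressed, and the closed interval on which primitives live; the endpoints are null.\<close>

lemma integrable_Ioo_iff:
  fixes f :: "real \<Rightarrow> complex"
  shows "integrable (lebesgue_on {a<..<b}) f \<longleftrightarrow> f absolutely_integrable_on {a..b}"
  unfolding absolutely_integrable_on_Icc_iff_Ioo by (simp add: integrable_restrict_space set_integrable_def)

lemma LINT_Ioo_eq_integral: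
  fixes f :: "real \<Rightarrow> complex"
  assumes "f absolutely_integrable_on {a..b}"
  shows "(LINT x|lebesgue_on {a<..<b}. f x) = integral {a..b} f"
  using assms lebesgue_integral_eq_integral[of "{a<..<b}" f]
  by (simp add: integrable_Ioo_iff integral_open_interval_real)

text \<open>Completeness of Lebesgue measure, transported to J by extension by 0. Representatives
  chosen by \<open>wderiv\<close> are compared only almost everywhere and obtain their measurability
  this way.\<close>

lemma borel_measurable_cong_AE_Ioo:
  fixes u v :: "real \<Rightarrow> complex"
  assumes "u \<in> borel_measurable (lebesgue_on {a<..<b})" "AE x in lebesgue_on {a<..<b}. u x = v x"
  shows "v \<in> borel_measurable (lebesgue_on {a<..<b})"
proof -
  have "(\<lambda>x. if x \<in> {a<..<b} then u x else 0) \<in> borel_measurable lebesgue"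
    using assms(1) by (intro borel_measurable_if_I) auto
  moreover have "AE x in lebesgue. (if x \<in> {a<..<b} then u x else 0) = (if x \<in> {a<..<b} then v x else 0)"
    using assms(2) unfolding AE_restrict_space_iff[of "{a<..<b}" lebesgue, simplified]
    by eventually_elim auto
  ultimately have "(\<lambda>x. if x \<in> {a<..<b} then v x else 0) \<in> borel_measurable lebesgue"
    by (rule borel_measurable_AE)
  then show ?thesis by (rule borel_measurable_if_D)
qed

lemma integrable_cong_AE_Ioo:
  fixes u v :: "real \<Rightarrow> complex"
  assumes "integrable (lebesgue_on {a<..<b}) u" "AE x in lebesgue_on {a<..<b}. u x = v x"
  shows "integrable (lebesgue_on {a<..<b}) v"
proof (rule integrable_cong_AE_imp[OF assms(1)])
  show "v \<in> borel_measurable (lebesgue_on {a<..<b})"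
    using borel_measurable_cong_AE_Ioo[OF _ assms(2)] assms(1) by auto
qed (rule assms(2))

lemma integrable_imp_locally_integrable:
  assumes "integrable (lebesgue_on {a<..<b}) u"
  shows "locally_integrable {a<..<b} u"
proof -
  have "u absolutely_integrable_on {a<..<b}"
    using assms by (simp add: integrable_restrict_space set_integrable_def)
  then show ?thesis
    unfolding locally_integrable_def
    using set_integrable_subset[of lebesgue "{a<..<b}" u] lmeasurable_compact fmeasurableD by blast
qed

lemma has_ac_deriv_cong_AE:
  assumes U: "has_ac_deriv a b U v" and vw: "AE x in lebesgue_on {a<..<b}. v x = w x"
  shows "has_ac_deriv a b U w"
proof (rule has_ac_derivI)
  have v: "v absolutely_integrable_on {a..b}" by (rule has_ac_derivD(1)[OF U])
  show w: "w absolutely_integrable_on {a..b}"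
    using integrable_cong_AE_Ioo[OF _ vw] v unfolding integrable_Ioo_iff by blast
  fix x assume x: "x \<in> {a..b}"
  have vx: "v absolutely_integrable_on {a..x}" "w absolutely_integrable_on {a..x}"
    using x by (auto intro: absolutely_integrable_subintervalD[OF v] absolutely_integrable_subintervalD[OF w])
  have "AE y in lebesgue. y \<in> {a<..<b} \<longrightarrow> v y = w y"
    using vw by (simp add: AE_restrict_space_iff)
  then have "AE y in lebesgue. y \<in> {a<..<x} \<longrightarrow> v y = w y"
    by eventually_elim (use x in auto)
  then have "AE y in lebesgue_on {a<..<x}. v y = w y"
    by (simp add: AE_restrict_space_iff)
  then have "(LINT y|lebesgue_on {a<..<x}. v y) = (LINT y|lebesgue_on {a<..<x}. w y)"
    using vx[folded integrable_Ioo_iff] by (intro integral_cong_AE) auto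
  then have "integral {a..x} v = integral {a..x} w"
    using vx by (simp add: LINT_Ioo_eq_integral)
  then show "U x = U a + integral {a..x} w"
    using has_ac_derivD(2)[OF U x] by simp
qed

text \<open>Both arguments may be changed on null sets; only the hidden U is a genuine primitive.
  The derivative is merely integrable, which admits functions not yet known to lie in W12.\<close>

definition has_ac_version :: "real \<Rightarrow> real \<Rightarrow> (real \<Rightarrow> complex) \<Rightarrow> (real \<Rightarrow> complex) \<Rightarrow> bool" where
  "has_ac_version a b u v \<longleftrightarrow> (\<exists>U. has_ac_deriv a b U v \<and> (AE x in lebesgue_on {a<..<b}. u x = U x))"

lemma has_ac_deriv_C1:
  assumes D: "deriv_seq D"
  shows "has_ac_deriv a b (D n) (D (Suc n))"
proof (rule has_ac_derivI)
  show "D (Suc n) absolutely_integrable_on {a..b}"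
    by (intro absolutely_integrable_continuous_real deriv_seq_continuous_on D)
  fix x assume x: "x \<in> {a..b}"
  have "(D (Suc n) has_integral D n x - D n a) {a..x}"
    using x D unfolding deriv_seq_def
    by (intro fundamental_theorem_of_calculus) (auto simp: has_vector_derivative_at_within)
  then show "D n x = D n a + integral {a..x} (D (Suc n))"
    by (simp add: integral_unique)
qed

lemma has_ac_deriv_by_parts:
  assumes U: "has_ac_deriv a b U v" and W: "has_ac_deriv a b W w" and ab: "a \<le> b"
    and W0: "W a = 0" "W b = 0"
  shows "(LINT x|lebesgue_on {a<..<b}. U x * w x) = - (LINT x|lebesgue_on {a<..<b}. v x * W x)"
proof -
  note UW = has_ac_deriv_mult[OF U W]
  have 1: "(\<lambda>x. v x * W x) absolutely_integrable_on {a..b}" "(\<lambda>x. U x * w x) absolutely_integrable_on {a..b}"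
    by (intro absolutely_integrable_continuous_mult has_ac_derivD(1)[OF U] has_ac_derivD(1)[OF W]
        has_ac_deriv_continuous_on[OF U] has_ac_deriv_continuous_on[OF W])+
  have "integral {a..b} (\<lambda>x. v x * W x + U x * w x) = 0"
    using has_ac_deriv_increment[OF UW, of a b] ab W0 by simp
  then have "integral {a..b} (\<lambda>x. v x * W x) + integral {a..b} (\<lambda>x. U x * w x) = 0"
    using 1 by (simp add: Henstock_Kurzweil_Integration.integral_add set_lebesgue_integral_eq_integral)
  then show ?thesis
    using 1 by (simp add: LINT_Ioo_eq_integral add_eq_0_iff)
qed

lemma has_ac_version_integrable:
  assumes "has_ac_version a b u v"
  shows "integrable (lebesgue_on {a<..<b}) u" "integrable (lebesgue_on {a<..<b}) v"
proof -
  obtain U where U: "has_ac_deriv a b U v" "AE x in lebesgue_on {a<..<b}. u x = U x"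
    using assms by (auto simp: has_ac_version_def)
  show "integrable (lebesgue_on {a<..<b}) v"
    using has_ac_derivD(1)[OF U(1)] by (simp add: integrable_Ioo_iff)
  have "integrable (lebesgue_on {a<..<b}) U"
    unfolding integrable_Ioo_iff by (intro absolutely_integrable_continuous_real has_ac_deriv_continuous_on[OF U(1)])
  then show "integrable (lebesgue_on {a<..<b}) u"
    by (rule integrable_cong_AE_Ioo) (use U(2) in eventually_elim, simp)
qed

lemma has_ac_version_imp_has_weak_derivative:
  assumes ab: "a < b" and uv: "has_ac_version a b u v"
  shows "has_weak_derivative {a<..<b} u v"
  unfolding has_weak_derivative_def
proof (intro conjI ballI)
  obtain U where U: "has_ac_deriv a b U v" "AE x in lebesgue_on {a<..<b}. u x = U x"
    using uv by (auto simp: has_ac_version_def)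
  note int = has_ac_version_integrable[OF uv]
  show "locally_integrable {a<..<b} u" "locally_integrable {a<..<b} v"
    by (intro integrable_imp_locally_integrable int)+
  fix \<phi> assume "\<phi> \<in> test_functions {a<..<b}"
  then obtain D c d where D: "D 0 = \<phi>" "deriv_seq D" and cd: "a < c" "c < d" "d < b"
    and \<phi>0: "\<And>x. x \<notin> {c..d} \<Longrightarrow> \<phi> x = 0"
    using test_functionsE[OF _ ab] by metis
  have D1: "vector_derivative \<phi> (at x) = D 1 x" for x
    using vector_derivative_deriv_seq[OF D(2), of 0] D(1) by simp
  have \<phi>: "has_ac_deriv a b \<phi> (D 1)"
    using has_ac_deriv_C1[OF D(2), of a b 0] D(1) by simp
  have D1int: "(\<lambda>x. U x * D 1 x) absolutely_integrable_on {a..b}"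
    by (intro absolutely_integrable_continuous_mult has_ac_deriv_continuous_on[OF U(1)]
        absolutely_integrable_continuous_real deriv_seq_continuous_on D)
  have AE: "AE x in lebesgue_on {a<..<b}. U x * D 1 x = u x * D 1 x"
      "AE x in lebesgue_on {a<..<b}. u x * D 1 x = U x * D 1 x"
    using U(2) by (eventually_elim, simp)+
  have "(LINT x|lebesgue_on {a<..<b}. u x * D 1 x) = (LINT x|lebesgue_on {a<..<b}. U x * D 1 x)"
    using D1int[folded integrable_Ioo_iff] integrable_cong_AE_Ioo[OF _ AE(1)]
    by (intro integral_cong_AE AE(2)) auto
  also have "\<dots> = - (LINT x|lebesgue_on {a<..<b}. v x * \<phi> x)"
    using ab cd by (intro has_ac_deriv_by_parts[OF U(1) \<phi>]) (auto simp: \<phi>0)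
  finally show "(LINT x|lebesgue_on {a<..<b}. u x * vector_derivative \<phi> (at x)) =
       - (LINT x|lebesgue_on {a<..<b}. v x * \<phi> x)"
    by (simp add: D1)
qed

text \<open>An indefinite integral V of v has the same weak derivative as u, so u - V annihilates
  all derivatives of test functions and is constant almost everywhere.\<close>

lemma has_weak_derivative_imp_has_ac_version:
  assumes ab: "a < b" and uv: "has_weak_derivative {a<..<b} u v"
    and v: "integrable (lebesgue_on {a<..<b}) v"
  shows "has_ac_version a b u v"
proof -
  define V where "V = (\<lambda>x. integral {a..x} v)"
  have V: "has_ac_deriv a b V v"
    using v by (intro has_ac_derivI) (auto simp: integrable_Ioo_iff V_def)
  have cV: "continuous_on {a..b} V" by (rule has_ac_deriv_continuous_on[OF V])
  have "has_ac_version a b V v"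
    using V by (auto simp: has_ac_version_def)
  then have V': "has_weak_derivative {a<..<b} V v"
    by (rule has_ac_version_imp_has_weak_derivative[OF ab])
  have li: "locally_integrable {a<..<b} u" "locally_integrable {a<..<b} V"
    using uv V' by (auto simp: has_weak_derivative_def)
  have "\<exists>k. AE x in lebesgue_on {a<..<b}. u x - V x = k"
  proof (rule du_Bois_Reymond[OF ab])
    show "locally_integrable {a<..<b} (\<lambda>x. u x - V x)"
      using li unfolding locally_integrable_def by (auto intro: set_integral_diff)
    fix \<phi> assume \<phi>: "\<phi> \<in> test_functions {a<..<b}"
    then obtain D c d where D: "D 0 = \<phi>" "deriv_seq D" and cd: "a < c" "c < d" "d < b"
      and \<phi>0: "\<And>x. x \<notin> {c..d} \<Longrightarrow> \<phi> x = 0"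
      using test_functionsE[OF _ ab] by metis
    have D1: "vector_derivative \<phi> (at x) = D 1 x" for x
      using vector_derivative_deriv_seq[OF D(2), of 0] D(1) by simp
    \<comment> \<open>The complement of {c..d} is open, so the derivative vanishes there too.
      Compact support is needed because u is only locally integrable.\<close>
    have D10: "D 1 x = 0" if "x \<notin> {c..d}" for x
    proof -
      have "((\<lambda>_. 0) has_vector_derivative 0) (at x)" by simp
      then have "(\<phi> has_vector_derivative 0) (at x)"
        by (rule has_vector_derivative_transform_within_open[where S = "- {c..d}"])
          (use that \<phi>0 in auto)
      then show ?thesis using D1[of x] vector_derivative_at by metis
    qed
    note I = locally_integrable_mult[OF _ deriv_seq_continuous_on[OF D(2)] cd(1,3) D10]
    have "(LINT x|lebesgue_on {a<..<b}. (u x - V x) * D 1 x) =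
       (LINT x|lebesgue_on {a<..<b}. u x * D 1 x) - (LINT x|lebesgue_on {a<..<b}. V x * D 1 x)"
      using I[OF li(1)] I[OF li(2)] by (simp add: left_diff_distrib)
    also have "\<dots> = 0"
      using uv V' \<phi> unfolding has_weak_derivative_def D1[symmetric] by simp
    finally show "(LINT x|lebesgue_on {a<..<b}. (u x - V x) * vector_derivative \<phi> (at x)) = 0"
      by (simp add: D1)
  qed
  then obtain k where k: "AE x in lebesgue_on {a<..<b}. u x - V x = k" by blast
  have "has_ac_deriv a b (\<lambda>x. V x + k) v"
    using v by (intro has_ac_derivI) (auto simp: integrable_Ioo_iff V_def)
  moreover have "AE x in lebesgue_on {a<..<b}. u x = V x + k"
    using k by eventually_elim (auto simp: algebra_simps)
  ultimately show ?thesis by (auto simp: has_ac_version_def)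
qed

lemma has_weak_derivative_unique:
  assumes ab: "a < b" and "has_weak_derivative {a<..<b} u v" "has_weak_derivative {a<..<b} u w"
  shows "AE x in lebesgue_on {a<..<b}. v x = w x"
proof -
  have li: "locally_integrable {a<..<b} v" "locally_integrable {a<..<b} w"
    using assms by (auto simp: has_weak_derivative_def)
  have "AE x in lebesgue_on {a<..<b}. v x - w x = 0"
  proof (rule fundamental_lemma)
    show "locally_integrable {a<..<b} (\<lambda>x. v x - w x)"
      using li unfolding locally_integrable_def by (auto intro: set_integral_diff)
    fix \<phi> assume \<phi>: "\<phi> \<in> test_functions {a<..<b}"
    then obtain D c d where D: "D 0 = \<phi>" "deriv_seq D" and cd: "a < c" "c < d" "d < b"
      and \<phi>0: "\<And>x. x \<notin> {c..d} \<Longrightarrow> \<phi> x = 0"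
      using test_functionsE[OF _ ab] by metis
    note I = locally_integrable_mult[OF _ deriv_seq_continuous_on[OF D(2), of UNIV 0, unfolded D(1)] cd(1,3) \<phi>0]
    show "(LINT x|lebesgue_on {a<..<b}. (v x - w x) * \<phi> x) = 0"
      using assms \<phi> I[OF li(1)] I[OF li(2)] by (simp add: left_diff_distrib has_weak_derivative_def)
  qed
  then show ?thesis by simp
qed

lemma wderiv_AE_eq:
  assumes ab: "a < b" and u: "has_weak_derivative {a<..<b} u v"
  shows "has_weak_derivative {a<..<b} u (wderiv {a<..<b} u)"
    and "AE x in lebesgue_on {a<..<b}. wderiv {a<..<b} u x = v x"
proof -
  show "has_weak_derivative {a<..<b} u (wderiv {a<..<b} u)"
    unfolding wderiv_def by (rule someI[where P = "has_weak_derivative {a<..<b} u", OF u])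
  then show "AE x in lebesgue_on {a<..<b}. wderiv {a<..<b} u x = v x"
    using has_weak_derivative_unique[OF ab _ u] by blast
qed

lemma has_ac_version_cong:
  assumes "has_ac_version a b u v" "AE x in lebesgue_on {a<..<b}. u x = u' x"
    "AE x in lebesgue_on {a<..<b}. v x = v' x"
  shows "has_ac_version a b u' v'"
proof -
  obtain U where U: "has_ac_deriv a b U v" "AE x in lebesgue_on {a<..<b}. u x = U x"
    using assms by (auto simp: has_ac_version_def)
  have "AE x in lebesgue_on {a<..<b}. u' x = U x"
    using U(2) assms(2) by eventually_elim simp
  then show ?thesis
    using has_ac_deriv_cong_AE[OF U(1) assms(3)] by (auto simp: has_ac_version_def)
qed

lemma has_ac_version_wderiv:
  assumes ab: "a < b" and u: "has_ac_version a b u v"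
  shows "AE x in lebesgue_on {a<..<b}. wderiv {a<..<b} u x = v x"
    and "has_ac_version a b u (wderiv {a<..<b} u)"
proof -
  show ae: "AE x in lebesgue_on {a<..<b}. wderiv {a<..<b} u x = v x"
    by (rule wderiv_AE_eq(2)[OF ab has_ac_version_imp_has_weak_derivative[OF ab u]])
  show "has_ac_version a b u (wderiv {a<..<b} u)"
    by (rule has_ac_version_cong[OF u _ AE_symmetric[OF ae]]) simp
qed

lemma has_ac_version_mult:
  assumes "has_ac_version a b u v" "has_ac_version a b u' v'"
  shows "has_ac_version a b (\<lambda>x. u x * u' x) (\<lambda>x. v x * u' x + u x * v' x)"
proof -
  obtain U where U: "has_ac_deriv a b U v" "AE x in lebesgue_on {a<..<b}. u x = U x"
    using assms by (auto simp: has_ac_version_def)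
  obtain U' where U': "has_ac_deriv a b U' v'" "AE x in lebesgue_on {a<..<b}. u' x = U' x"
    using assms by (auto simp: has_ac_version_def)
  have "has_ac_version a b (\<lambda>x. U x * U' x) (\<lambda>x. v x * U' x + U x * v' x)"
    using has_ac_deriv_mult[OF U(1) U'(1)] by (auto simp: has_ac_version_def)
  then show ?thesis
  proof (rule has_ac_version_cong)
    show "AE x in lebesgue_on {a<..<b}. U x * U' x = u x * u' x"
      using U(2) U'(2) by eventually_elim simp
    show "AE x in lebesgue_on {a<..<b}. v x * U' x + U x * v' x = v x * u' x + u x * v' x"
      using U(2) U'(2) by eventually_elim simp
  qed
qed

section \<open>Sobolev functions on a bounded interval\<close>

lemma L2_measurable: "u \<in> L2 J \<Longrightarrow> u \<in> borel_measurable (lebesgue_on J)"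
  and L2_square_integrable: "u \<in> L2 J \<Longrightarrow> integrable (lebesgue_on J) (\<lambda>x. (cmod (u x))\<^sup>2)"
  by (auto simp: L2_def)

lemma L2_mult_integrable:
  assumes u: "u \<in> L2 J" and v: "v \<in> L2 J"
  shows "integrable (lebesgue_on J) (\<lambda>x. u x * v x)"
proof (rule Bochner_Integration.integrable_bound)
  show "integrable (lebesgue_on J) (\<lambda>x. (cmod (u x))\<^sup>2 + (cmod (v x))\<^sup>2)"
    by (intro Bochner_Integration.integrable_add L2_square_integrable u v)
  show "(\<lambda>x. u x * v x) \<in> borel_measurable (lebesgue_on J)"
    by (intro borel_measurable_times L2_measurable u v)
  have "s * t \<le> s\<^sup>2 + t\<^sup>2" if "s \<ge> 0" "t \<ge> 0" for s t :: real
    using sum_squares_bound[of s t] that mult_nonneg_nonneg[OF that] by linarith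
  then show "AE x in lebesgue_on J. norm (u x * v x) \<le> norm ((cmod (u x))\<^sup>2 + (cmod (v x))\<^sup>2)"
    by (auto simp: norm_mult)
qed

lemma L2_add:
  assumes u: "u \<in> L2 J" and v: "v \<in> L2 J"
  shows "(\<lambda>x. u x + v x) \<in> L2 J"
  unfolding L2_def
proof (intro CollectI conjI)
  show m: "(\<lambda>x. u x + v x) \<in> borel_measurable (lebesgue_on J)"
    by (intro borel_measurable_add L2_measurable u v)
  show "integrable (lebesgue_on J) (\<lambda>x. (cmod (u x + v x))\<^sup>2)"
  proof (rule Bochner_Integration.integrable_bound)
    show "integrable (lebesgue_on J) (\<lambda>x. 2 * (cmod (u x))\<^sup>2 + 2 * (cmod (v x))\<^sup>2)"
      by (intro Bochner_Integration.integrable_add integrable_mult_right L2_square_integrable u v)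
    show "(\<lambda>x. (cmod (u x + v x))\<^sup>2) \<in> borel_measurable (lebesgue_on J)"
      using m by measurable
    have "(cmod (s + t))\<^sup>2 \<le> 2 * (cmod s)\<^sup>2 + 2 * (cmod t)\<^sup>2" for s t
    proof -
      have "(cmod (s + t))\<^sup>2 \<le> (cmod s + cmod t)\<^sup>2"
        by (intro power_mono norm_triangle_ineq) auto
      also have "\<dots> \<le> 2 * (cmod s)\<^sup>2 + 2 * (cmod t)\<^sup>2"
        using sum_squares_bound[of "cmod s" "cmod t"] by (simp add: power2_sum)
      finally show ?thesis .
    qed
    then show "AE x in lebesgue_on J. norm ((cmod (u x + v x))\<^sup>2) \<le> norm (2 * (cmod (u x))\<^sup>2 + 2 * (cmod (v x))\<^sup>2)"
      by auto
  qed
qed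

lemma L2_minus: "u \<in> L2 J \<Longrightarrow> (\<lambda>x. - u x) \<in> L2 J"
  by (auto simp: L2_def)

lemma L2_diff: "u \<in> L2 J \<Longrightarrow> v \<in> L2 J \<Longrightarrow> (\<lambda>x. u x - v x) \<in> L2 J"
  using L2_add[OF _ L2_minus, of u J v] by simp

lemma L2_cong_AE:
  assumes u: "u \<in> L2 {a<..<b}" and uv: "AE x in lebesgue_on {a<..<b}. u x = v x"
  shows "v \<in> L2 {a<..<b}"
  unfolding L2_def
proof (intro CollectI conjI)
  show m: "v \<in> borel_measurable (lebesgue_on {a<..<b})"
    by (rule borel_measurable_cong_AE_Ioo[OF L2_measurable[OF u] uv])
  show "integrable (lebesgue_on {a<..<b}) (\<lambda>x. (cmod (v x))\<^sup>2)"
  proof (rule integrable_cong_AE_imp[OF L2_square_integrable[OF u]])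
    show "(\<lambda>x. (cmod (v x))\<^sup>2) \<in> borel_measurable (lebesgue_on {a<..<b})"
      using m by measurable
    show "AE x in lebesgue_on {a<..<b}. (cmod (u x))\<^sup>2 = (cmod (v x))\<^sup>2"
      using uv by eventually_elim simp
  qed
qed

lemma L2_mult_continuous:
  assumes c: "continuous_on {a..b} g" and u: "u \<in> L2 {a<..<b}"
  shows "(\<lambda>x. g x * u x) \<in> L2 {a<..<b}"
  unfolding L2_def
proof (intro CollectI conjI)
  have "g \<in> borel_measurable (lebesgue_on {a<..<b})"
    by (intro continuous_imp_measurable_on_sets_lebesgue continuous_on_subset[OF c]) auto
  then show m: "(\<lambda>x. g x * u x) \<in> borel_measurable (lebesgue_on {a<..<b})"
    by (intro borel_measurable_times L2_measurable[OF u])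
  have "bounded (g ` {a..b})"
    by (intro compact_imp_bounded compact_continuous_image c compact_Icc)
  then obtain B where B: "\<And>x. x \<in> {a..b} \<Longrightarrow> cmod (g x) \<le> B"
    unfolding bounded_iff by blast
  show "integrable (lebesgue_on {a<..<b}) (\<lambda>x. (cmod (g x * u x))\<^sup>2)"
  proof (rule Bochner_Integration.integrable_bound)
    show "integrable (lebesgue_on {a<..<b}) (\<lambda>x. B\<^sup>2 * (cmod (u x))\<^sup>2)"
      by (intro integrable_mult_right L2_square_integrable u)
    show "(\<lambda>x. (cmod (g x * u x))\<^sup>2) \<in> borel_measurable (lebesgue_on {a<..<b})"
      using m by measurable
    have "(cmod (g x * u x))\<^sup>2 \<le> B\<^sup>2 * (cmod (u x))\<^sup>2" if "x \<in> {a<..<b}" for x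
    proof -
      have "(cmod (g x))\<^sup>2 \<le> B\<^sup>2"
        using B[of x] that by (intro power_mono) auto
      then show ?thesis
        by (simp add: norm_mult power_mult_distrib mult_right_mono)
    qed
    then show "AE x in lebesgue_on {a<..<b}. norm ((cmod (g x * u x))\<^sup>2) \<le> norm (B\<^sup>2 * (cmod (u x))\<^sup>2)"
      by (intro AE_I2) simp
  qed
qed

lemma L2_const: "(\<lambda>_. c) \<in> L2 {a<..<b}"
proof -
  interpret finite_measure "lebesgue_on {a<..<b}"
    by (rule finite_measure_lebesgue_on) simp
  show ?thesis by (simp add: L2_def)
qed

lemma L2_integrable: "u \<in> L2 {a<..<b} \<Longrightarrow> integrable (lebesgue_on {a<..<b}) u"
  using L2_mult_integrable[OF L2_const, of u a b 1] by simp

text \<open>A continuous version is bounded on the compact interval. This is the source of the gain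
  from integrable to square integrable products.\<close>

lemma has_ac_version_L2_mult:
  assumes u: "has_ac_version a b u v" and w: "w \<in> L2 {a<..<b}"
  shows "(\<lambda>x. u x * w x) \<in> L2 {a<..<b}"
proof -
  obtain U where U: "has_ac_deriv a b U v" "AE x in lebesgue_on {a<..<b}. u x = U x"
    using u by (auto simp: has_ac_version_def)
  have "(\<lambda>x. U x * w x) \<in> L2 {a<..<b}"
    by (intro L2_mult_continuous has_ac_deriv_continuous_on[OF U(1)] w)
  moreover have "AE x in lebesgue_on {a<..<b}. U x * w x = u x * w x"
    using U(2) by eventually_elim simp
  ultimately show ?thesis by (rule L2_cong_AE)
qed

lemma has_ac_version_L2: "has_ac_version a b u v \<Longrightarrow> u \<in> L2 {a<..<b}"
  using has_ac_version_L2_mult[OF _ L2_const, of a b u v 1] by simp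

lemma sobolev_1I:
  assumes "a < b" "has_ac_version a b u v" "v \<in> L2 {a<..<b}"
  shows "u \<in> sobolev 1 {a<..<b}"
  using assms has_ac_version_imp_has_weak_derivative[OF assms(1,2)] has_ac_version_L2[OF assms(2)]
  by auto

lemma sobolev_1D:
  assumes ab: "a < b" and u: "u \<in> sobolev 1 {a<..<b}"
  shows "has_ac_version a b u (wderiv {a<..<b} u)" "wderiv {a<..<b} u \<in> L2 {a<..<b}" "u \<in> L2 {a<..<b}"
proof -
  show "u \<in> L2 {a<..<b}" using u by simp
  obtain v where v: "v \<in> L2 {a<..<b}" "has_weak_derivative {a<..<b} u v"
    using u by auto
  have uv: "has_ac_version a b u v"
    by (rule has_weak_derivative_imp_has_ac_version[OF ab v(2) L2_integrable[OF v(1)]])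
  show "has_ac_version a b u (wderiv {a<..<b} u)"
    by (rule has_ac_version_wderiv[OF ab uv])
  show "wderiv {a<..<b} u \<in> L2 {a<..<b}"
    by (rule L2_cong_AE[OF v(1) AE_symmetric[OF has_ac_version_wderiv(1)[OF ab uv]]])
qed

lemma sobolev_1_cong_AE:
  assumes ab: "a < b" and u: "u \<in> sobolev 1 {a<..<b}" and ae: "AE x in lebesgue_on {a<..<b}. u x = v x"
  shows "v \<in> sobolev 1 {a<..<b}"
  by (rule sobolev_1I[OF ab has_ac_version_cong[OF sobolev_1D(1)[OF ab u] ae] sobolev_1D(2)[OF ab u]]) simp

text \<open>In one dimension W12 functions are bounded, so both terms of the product rule stay in
  L2. In particular the product inside \<open>S_dist\<close> is a legitimate argument of
  \<open>q_dist\<close>.\<close>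

lemma sobolev_1_mult:
  assumes ab: "a < b" and u: "u \<in> sobolev 1 {a<..<b}" and v: "v \<in> sobolev 1 {a<..<b}"
  shows "(\<lambda>x. u x * v x) \<in> sobolev 1 {a<..<b}"
proof (rule sobolev_1I[OF ab has_ac_version_mult[OF sobolev_1D(1)[OF ab u] sobolev_1D(1)[OF ab v]]])
  show "(\<lambda>x. wderiv {a<..<b} u x * v x + u x * wderiv {a<..<b} v x) \<in> L2 {a<..<b}"
    using has_ac_version_L2_mult[OF sobolev_1D(1)[OF ab v] sobolev_1D(2)[OF ab u]]
      has_ac_version_L2_mult[OF sobolev_1D(1)[OF ab u] sobolev_1D(2)[OF ab v]]
    by (intro L2_add) (simp_all add: mult.commute)
qed

lemma wderiv_mult:
  assumes ab: "a < b" and u: "u \<in> sobolev 1 {a<..<b}" and v: "v \<in> sobolev 1 {a<..<b}"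
  shows "AE x in lebesgue_on {a<..<b}. wderiv {a<..<b} (\<lambda>x. u x * v x) x =
     wderiv {a<..<b} u x * v x + u x * wderiv {a<..<b} v x"
  by (rule has_ac_version_wderiv(1)[OF ab has_ac_version_mult[OF sobolev_1D(1)[OF ab u] sobolev_1D(1)[OF ab v]]])

lemma wderiv_cong_AE:
  assumes ab: "a < b" and u: "u \<in> sobolev 1 {a<..<b}" and ae: "AE x in lebesgue_on {a<..<b}. u x = v x"
  shows "AE x in lebesgue_on {a<..<b}. wderiv {a<..<b} v x = wderiv {a<..<b} u x"
  by (rule has_ac_version_wderiv(1)[OF ab has_ac_version_cong[OF sobolev_1D(1)[OF ab u] ae]]) simp

lemma sobolev_2I:
  assumes ab: "a < b" and u: "has_ac_version a b u v" and v: "v \<in> sobolev 1 {a<..<b}"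
  shows "u \<in> sobolev 2 {a<..<b}"
  using has_ac_version_imp_has_weak_derivative[OF ab u] has_ac_version_L2[OF u] v
  by (auto simp: numeral_2_eq_2)

lemma sobolev_2D:
  assumes ab: "a < b" and u: "u \<in> sobolev 2 {a<..<b}"
  shows "u \<in> sobolev 1 {a<..<b}" "wderiv {a<..<b} u \<in> sobolev 1 {a<..<b}"
proof -
  obtain v where v: "v \<in> sobolev 1 {a<..<b}" "has_weak_derivative {a<..<b} u v"
    using u by (auto simp: numeral_2_eq_2)
  have L2: "v \<in> L2 {a<..<b}" by (rule sobolev_1D(3)[OF ab v(1)])
  have uv: "has_ac_version a b u v"
    by (rule has_weak_derivative_imp_has_ac_version[OF ab v(2) L2_integrable[OF L2]])
  show "u \<in> sobolev 1 {a<..<b}" by (rule sobolev_1I[OF ab uv L2])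
  show "wderiv {a<..<b} u \<in> sobolev 1 {a<..<b}"
    by (rule sobolev_1_cong_AE[OF ab v(1) AE_symmetric[OF has_ac_version_wderiv(1)[OF ab uv]]])
qed

section \<open>Test functions, their closure, and integration by parts\<close>

lemma test_function_sobolev_1:
  assumes ab: "a < b" and \<phi>: "\<phi> \<in> test_functions {a<..<b}"
  shows "\<phi> \<in> sobolev 1 {a<..<b}"
    and "AE x in lebesgue_on {a<..<b}. wderiv {a<..<b} \<phi> x = vector_derivative \<phi> (at x)"
proof -
  obtain D where D: "D 0 = \<phi>" "deriv_seq D"
    using test_functionsE[OF \<phi> ab] by metis
  have V: "has_ac_version a b (D n) (D (Suc n))" for n
    using has_ac_deriv_C1[OF D(2)] by (auto simp: has_ac_version_def)
  have \<phi>V: "has_ac_version a b \<phi> (D 1)"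
    using V[of 0] D(1) by simp
  show "\<phi> \<in> sobolev 1 {a<..<b}"
    by (rule sobolev_1I[OF ab \<phi>V has_ac_version_L2[OF V]])
  show "AE x in lebesgue_on {a<..<b}. wderiv {a<..<b} \<phi> x = vector_derivative \<phi> (at x)"
    using has_ac_version_wderiv(1)[OF ab \<phi>V] vector_derivative_deriv_seq[OF D(2), of 0] D(1) by simp
qed

lemma sobolev_1_diff:
  assumes ab: "a < b" and u: "u \<in> sobolev 1 {a<..<b}" and v: "v \<in> sobolev 1 {a<..<b}"
  shows "(\<lambda>x. u x - v x) \<in> sobolev 1 {a<..<b}"
    and "AE x in lebesgue_on {a<..<b}. wderiv {a<..<b} (\<lambda>x. u x - v x) x = wderiv {a<..<b} u x - wderiv {a<..<b} v x"
proof -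
  obtain U where U: "has_ac_deriv a b U (wderiv {a<..<b} u)" "AE x in lebesgue_on {a<..<b}. u x = U x"
    using sobolev_1D(1)[OF ab u] by (auto simp: has_ac_version_def)
  obtain V where V: "has_ac_deriv a b V (wderiv {a<..<b} v)" "AE x in lebesgue_on {a<..<b}. v x = V x"
    using sobolev_1D(1)[OF ab v] by (auto simp: has_ac_version_def)
  have "has_ac_deriv a b (\<lambda>x. U x - V x) (\<lambda>x. wderiv {a<..<b} u x - wderiv {a<..<b} v x)"
  proof (rule has_ac_derivI)
    show "(\<lambda>x. wderiv {a<..<b} u x - wderiv {a<..<b} v x) absolutely_integrable_on {a..b}"
      by (intro set_integral_diff has_ac_derivD(1)[OF U(1)] has_ac_derivD(1)[OF V(1)])
    fix x assume x: "x \<in> {a..b}"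
    have "wderiv {a<..<b} u integrable_on {a..x}" "wderiv {a<..<b} v integrable_on {a..x}"
      using x by (auto intro: absolutely_integrable_subintervalD[OF has_ac_derivD(1)[OF U(1)]]
          absolutely_integrable_subintervalD[OF has_ac_derivD(1)[OF V(1)]])
    then have "integral {a..x} (\<lambda>x. wderiv {a<..<b} u x - wderiv {a<..<b} v x) = (U x - U a) - (V x - V a)"
      using has_ac_derivD(2)[OF U(1) x] has_ac_derivD(2)[OF V(1) x]
      by (simp add: Henstock_Kurzweil_Integration.integral_diff)
    then show "U x - V x = U a - V a + integral {a..x} (\<lambda>x. wderiv {a<..<b} u x - wderiv {a<..<b} v x)"
      by simp
  qed
  moreover have "AE x in lebesgue_on {a<..<b}. u x - v x = U x - V x"
    using U(2) V(2) by eventually_elim simp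
  ultimately have *: "has_ac_version a b (\<lambda>x. u x - v x) (\<lambda>x. wderiv {a<..<b} u x - wderiv {a<..<b} v x)"
    by (auto simp: has_ac_version_def)
  show "(\<lambda>x. u x - v x) \<in> sobolev 1 {a<..<b}"
    by (rule sobolev_1I[OF ab * L2_diff[OF sobolev_1D(2)[OF ab u] sobolev_1D(2)[OF ab v]]])
  show "AE x in lebesgue_on {a<..<b}. wderiv {a<..<b} (\<lambda>x. u x - v x) x = wderiv {a<..<b} u x - wderiv {a<..<b} v x"
    by (rule has_ac_version_wderiv(1)[OF ab *])
qed

lemma test_function_sobolev0:
  assumes ab: "a < b" and \<phi>: "\<phi> \<in> test_functions {a<..<b}"
  shows "\<phi> \<in> sobolev0 {a<..<b}"
proof -
  note s = test_function_sobolev_1(1)[OF ab \<phi>]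
  \<comment> \<open>Even for the zero function \<open>wderiv\<close> is some chosen representative,
    hence zero only almost everywhere; this suffices for the norm.\<close>
  have "AE x in lebesgue_on {a<..<b}. wderiv {a<..<b} (\<lambda>x. \<phi> x - \<phi> x) x = 0"
    using sobolev_1_diff(2)[OF ab s s] by simp
  then have "AE x in lebesgue_on {a<..<b}. (cmod (wderiv {a<..<b} (\<lambda>x. \<phi> x - \<phi> x) x))\<^sup>2 = 0"
    by eventually_elim simp
  then have "W12_norm {a<..<b} (\<lambda>x. \<phi> x - \<phi> x) = 0"
    by (simp add: W12_norm_def integral_eq_zero_AE)
  then show ?thesis
    unfolding sobolev0_def using s \<phi> by (auto intro!: exI[of _ "\<lambda>_. \<phi>"])
qed

text \<open>The weighted inequality r s \<le> t r^2 + s^2 / t, applied pointwise, stands in for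
  Cauchy-Schwarz. The weight t stays free so that the term in h can be sent to 0 at fixed t, and t
  afterwards.\<close>

lemma W12_pairing_bound:
  assumes ab: "a < b" and w: "w \<in> sobolev 1 {a<..<b}" and h: "h \<in> sobolev 1 {a<..<b}" and t: "t > 0"
  shows "cmod (LINT x|lebesgue_on {a<..<b}. w x * wderiv {a<..<b} h x + wderiv {a<..<b} w x * h x)
    \<le> t * (W12_norm {a<..<b} w)\<^sup>2 + (W12_norm {a<..<b} h)\<^sup>2 / t"
proof -
  let ?M = "lebesgue_on {a<..<b}"
  let ?w = "wderiv {a<..<b} w" and ?h = "wderiv {a<..<b} h"
  note W = sobolev_1D[OF ab w] and H = sobolev_1D[OF ab h]
  have norm: "(W12_norm {a<..<b} u)\<^sup>2 = (LINT x|?M. (cmod (u x))\<^sup>2) + (LINT x|?M. (cmod (wderiv {a<..<b} u x))\<^sup>2)" for u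
    by (simp add: W12_norm_def)
  have ag: "r * s \<le> t * r\<^sup>2 + s\<^sup>2 / t" if "r \<ge> 0" "s \<ge> 0" for r s :: real
  proof -
    have "0 \<le> (t * r - s)\<^sup>2 / t + r * s"
      using t that by simp
    also have "\<dots> = t * r\<^sup>2 + s\<^sup>2 / t - r * s"
      using t by (simp add: power2_diff field_simps power2_eq_square)
    finally show ?thesis by simp
  qed
  have "cmod (LINT x|?M. w x * ?h x + ?w x * h x) \<le>
      (LINT x|?M. t * (cmod (w x))\<^sup>2 + t * (cmod (?w x))\<^sup>2 + ((cmod (h x))\<^sup>2 / t + (cmod (?h x))\<^sup>2 / t))"
  proof (rule Bochner_Integration.integral_norm_bound_integral)
    show "integrable ?M (\<lambda>x. w x * ?h x + ?w x * h x)"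
      by (intro Bochner_Integration.integrable_add L2_mult_integrable W H)
    show "integrable ?M (\<lambda>x. t * (cmod (w x))\<^sup>2 + t * (cmod (?w x))\<^sup>2 + ((cmod (h x))\<^sup>2 / t + (cmod (?h x))\<^sup>2 / t))"
      by (intro Bochner_Integration.integrable_add integrable_mult_right integrable_divide L2_square_integrable W H)
    fix x
    have "norm (w x * ?h x + ?w x * h x) \<le> cmod (w x) * cmod (?h x) + cmod (?w x) * cmod (h x)"
      by (metis norm_mult norm_triangle_ineq)
    also have "\<dots> \<le> (t * (cmod (w x))\<^sup>2 + (cmod (?h x))\<^sup>2 / t) + (t * (cmod (?w x))\<^sup>2 + (cmod (h x))\<^sup>2 / t)"
      by (intro add_mono ag norm_ge_zero)
    finally show "norm (w x * ?h x + ?w x * h x) \<le>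
       t * (cmod (w x))\<^sup>2 + t * (cmod (?w x))\<^sup>2 + ((cmod (h x))\<^sup>2 / t + (cmod (?h x))\<^sup>2 / t)" by simp
  qed
  also have "\<dots> = t * (W12_norm {a<..<b} w)\<^sup>2 + (W12_norm {a<..<b} h)\<^sup>2 / t"
    using L2_square_integrable[OF W(2)] L2_square_integrable[OF W(3)]
      L2_square_integrable[OF H(2)] L2_square_integrable[OF H(3)]
    by (simp add: norm add_divide_distrib distrib_left)
  finally show ?thesis .
qed

text \<open>The form \<integral> w \<phi>' + w' \<phi> is linear in \<phi> and vanishes on test
  functions by the definition of the weak derivative, so its value K at \<phi> equals its value at
  \<phi> - \<psi> n for every n. The pairing bound then gives K = 0.\<close>

lemma sobolev0_by_parts:
  assumes ab: "a < b" and w: "w \<in> sobolev 1 {a<..<b}" and \<phi>: "\<phi> \<in> sobolev0 {a<..<b}"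
  shows "(LINT x|lebesgue_on {a<..<b}. w x * wderiv {a<..<b} \<phi> x) =
    - (LINT x|lebesgue_on {a<..<b}. wderiv {a<..<b} w x * \<phi> x)"
proof -
  let ?M = "lebesgue_on {a<..<b}"
  let ?w = "wderiv {a<..<b} w" and ?\<phi> = "wderiv {a<..<b} \<phi>"
  have s\<phi>: "\<phi> \<in> sobolev 1 {a<..<b}" using \<phi> by (simp add: sobolev0_def)
  obtain \<psi> where \<psi>: "\<And>n. \<psi> n \<in> test_functions {a<..<b}"
    and lim: "(\<lambda>n. W12_norm {a<..<b} (\<lambda>x. \<phi> x - \<psi> n x)) \<longlonglongrightarrow> 0"
    using \<phi> by (auto simp: sobolev0_def)
  have s\<psi>: "\<psi> n \<in> sobolev 1 {a<..<b}" for n by (rule test_function_sobolev_1[OF ab \<psi>])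
  note W = sobolev_1D[OF ab w] and P = sobolev_1D[OF ab s\<phi>] and Q = sobolev_1D[OF ab s\<psi>]
  define K where "K = (LINT x|?M. w x * ?\<phi> x + ?w x * \<phi> x)"
  have K: "K = (LINT x|?M. w x * wderiv {a<..<b} (\<lambda>x. \<phi> x - \<psi> n x) x + ?w x * (\<phi> x - \<psi> n x))" for n
  proof -
    have "(LINT x|?M. w x * wderiv {a<..<b} (\<psi> n) x) = (LINT x|?M. w x * vector_derivative (\<psi> n) (at x))"
    proof (rule integral_cong_AE)
      show ae: "AE x in ?M. w x * wderiv {a<..<b} (\<psi> n) x = w x * vector_derivative (\<psi> n) (at x)"
        using test_function_sobolev_1(2)[OF ab \<psi>[of n]] by eventually_elim simp
      show "(\<lambda>x. w x * wderiv {a<..<b} (\<psi> n) x) \<in> borel_measurable ?M"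
        by (intro borel_measurable_integrable L2_mult_integrable W Q)
      then show "(\<lambda>x. w x * vector_derivative (\<psi> n) (at x)) \<in> borel_measurable ?M"
        using ae by (rule borel_measurable_cong_AE_Ioo)
    qed
    also have "\<dots> = - (LINT x|?M. ?w x * \<psi> n x)"
      using has_ac_version_imp_has_weak_derivative[OF ab W(1)] \<psi>[of n] by (simp add: has_weak_derivative_def)
    finally have z: "(LINT x|?M. w x * wderiv {a<..<b} (\<psi> n) x + ?w x * \<psi> n x) = 0"
      using L2_mult_integrable[OF W(3) Q(2)[of n]] L2_mult_integrable[OF W(2) Q(3)[of n]] by simp
    have i: "integrable ?M (\<lambda>x. w x * ?\<phi> x + ?w x * \<phi> x)"
      "integrable ?M (\<lambda>x. w x * wderiv {a<..<b} (\<psi> n) x + ?w x * \<psi> n x)"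
      by (intro Bochner_Integration.integrable_add L2_mult_integrable W P Q)+
    have d: "(\<lambda>x. \<phi> x - \<psi> n x) \<in> sobolev 1 {a<..<b}" by (rule sobolev_1_diff[OF ab s\<phi> s\<psi>])
    have "K = (LINT x|?M. (w x * ?\<phi> x + ?w x * \<phi> x) - (w x * wderiv {a<..<b} (\<psi> n) x + ?w x * \<psi> n x))"
      using i z by (simp add: K_def)
    also have "\<dots> = (LINT x|?M. w x * wderiv {a<..<b} (\<lambda>x. \<phi> x - \<psi> n x) x + ?w x * (\<phi> x - \<psi> n x))"
    proof (rule integral_cong_AE)
      show "AE x in ?M. (w x * ?\<phi> x + ?w x * \<phi> x) - (w x * wderiv {a<..<b} (\<psi> n) x + ?w x * \<psi> n x)
         = w x * wderiv {a<..<b} (\<lambda>x. \<phi> x - \<psi> n x) x + ?w x * (\<phi> x - \<psi> n x)"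
        using sobolev_1_diff(2)[OF ab s\<phi> s\<psi>[of n]] by eventually_elim (simp add: right_diff_distrib)
      show "(\<lambda>x. (w x * ?\<phi> x + ?w x * \<phi> x) - (w x * wderiv {a<..<b} (\<psi> n) x + ?w x * \<psi> n x)) \<in> borel_measurable ?M"
        using i by (intro borel_measurable_diff) auto
      show "(\<lambda>x. w x * wderiv {a<..<b} (\<lambda>x. \<phi> x - \<psi> n x) x + ?w x * (\<phi> x - \<psi> n x)) \<in> borel_measurable ?M"
        using sobolev_1D[OF ab d]
        by (intro borel_measurable_integrable Bochner_Integration.integrable_add L2_mult_integrable W) auto
    qed
    finally show ?thesis .
  qed
  have bound: "cmod K \<le> t * (W12_norm {a<..<b} w)\<^sup>2" if t: "t > 0" for t
  proof (rule LIMSEQ_le_const)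
    show "(\<lambda>n. t * (W12_norm {a<..<b} w)\<^sup>2 + (W12_norm {a<..<b} (\<lambda>x. \<phi> x - \<psi> n x))\<^sup>2 / t)
        \<longlonglongrightarrow> t * (W12_norm {a<..<b} w)\<^sup>2"
      using t by (auto intro!: tendsto_eq_intros lim)
    show "\<exists>N. \<forall>n\<ge>N. cmod K \<le> t * (W12_norm {a<..<b} w)\<^sup>2 + (W12_norm {a<..<b} (\<lambda>x. \<phi> x - \<psi> n x))\<^sup>2 / t"
    proof (intro exI allI impI)
      fix n
      show "cmod K \<le> t * (W12_norm {a<..<b} w)\<^sup>2 + (W12_norm {a<..<b} (\<lambda>x. \<phi> x - \<psi> n x))\<^sup>2 / t"
        unfolding K[of n] by (rule W12_pairing_bound[OF ab w sobolev_1_diff(1)[OF ab s\<phi> s\<psi>] t])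
    qed
  qed
  have "cmod K \<le> 0"
  proof (rule field_le_epsilon)
    fix e :: real assume e: "e > 0"
    let ?A = "(W12_norm {a<..<b} w)\<^sup>2"
    \<comment> \<open>The weight e / (A + 1) leaves e A / (A + 1) \<le> e; the summand 1 covers the
      case A = 0.\<close>
    have "cmod K \<le> e / (?A + 1) * ?A"
      using e by (intro bound divide_pos_pos) (auto intro: add_nonneg_pos)
    also have "\<dots> = e * (?A / (?A + 1))" by simp
    also have "\<dots> \<le> e * 1"
      using e by (intro mult_left_mono) (auto simp: divide_le_eq_1 add_nonneg_pos)
    finally show "cmod K \<le> 0 + e" by simp
  qed
  then have "K = 0" by simp
  then show ?thesis
    unfolding K_def using L2_mult_integrable[OF W(3) P(2)] L2_mult_integrable[OF W(2) P(3)]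
    by (simp add: add_eq_0_iff2)
qed

text \<open>The norm of the difference is continuous and nonnegative with integral 0, so it vanishes
  everywhere, endpoints included.\<close>

lemma continuous_AE_eq:
  fixes f g :: "real \<Rightarrow> complex"
  assumes ab: "a < b" and f: "continuous_on {a..b} f" and g: "continuous_on {a..b} g"
    and ae: "AE x in lebesgue_on {a<..<b}. f x = g x" and x: "x \<in> {a..b}"
  shows "f x = g x"
proof -
  define h where "h = (\<lambda>x. norm (f x - g x))"
  have c: "continuous_on {a..b} h"
    unfolding h_def by (intro continuous_intros f g)
  have "integral {a..b} h = integral {a<..<b} h"
    by (rule integral_open_interval_real)
  also have "\<dots> = (LINT x|lebesgue_on {a<..<b}. h x)"
  proof (rule lebesgue_integral_eq_integral[symmetric])
    have "h absolutely_integrable_on {a..b}" by (intro absolutely_integrable_continuous_real c)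
    then show "integrable (lebesgue_on {a<..<b}) h"
      unfolding absolutely_integrable_on_Icc_iff_Ioo by (simp add: integrable_restrict_space set_integrable_def)
  qed auto
  also have "\<dots> = 0"
    by (rule integral_eq_zero_AE) (use ae in eventually_elim, simp add: h_def)
  finally have "(h has_integral 0) (cbox a b)"
    using integrable_integral[OF integrable_continuous_real[OF c]] by simp
  then have "h x = 0"
    using c x ab by (intro has_integral_0_cbox_imp_0[of a b h]) (auto simp: h_def)
  then show ?thesis by (simp add: h_def)
qed

section \<open>The factorised Schroedinger operator\<close>

locale nonvanishing_sobolev =
  fixes a b :: real and f :: "real \<Rightarrow> complex"
  assumes ab: "a < b" and f: "f \<in> sobolev 1 {a<..<b}" and cont: "continuous_on {a..b} f"
    and nz: "\<And>x. x \<in> {a..b} \<Longrightarrow> f x \<noteq> 0"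
begin

abbreviation J :: "real set" where "J \<equiv> {a<..<b}"
abbreviation M :: "real measure" where "M \<equiv> lebesgue_on J"
abbreviation W12 :: "(real \<Rightarrow> complex) set" where "W12 \<equiv> sobolev 1 J"

definition log_deriv :: "real \<Rightarrow> complex" where "log_deriv x = wderiv J f x / f x"

lemma AE_f_nz: "AE x in M. f x \<noteq> 0"
  using nz by (intro AE_I2) auto

text \<open>The rule for 1/f is pointwise, so \<open>f\<close> itself, and not just a version of it,
  has to be a primitive; continuity identifies the two on all of {a..b}.\<close>

lemma f_ac: "has_ac_deriv a b f (wderiv J f)"
proof -
  obtain F where F: "has_ac_deriv a b F (wderiv J f)" "AE x in M. f x = F x"
    using sobolev_1D(1)[OF ab f] by (auto simp: has_ac_version_def)
  have eq: "f x = F x" if "x \<in> {a..b}" for x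
    by (rule continuous_AE_eq[OF ab cont has_ac_deriv_continuous_on[OF F(1)] F(2) that])
  show ?thesis
  proof (rule has_ac_derivI[OF has_ac_derivD(1)[OF F(1)]])
    fix x assume "x \<in> {a..b}"
    then show "f x = f a + integral {a..x} (wderiv J f)"
      using eq[of x] eq[of a] ab has_ac_derivD(2)[OF F(1), of x] by simp
  qed
qed

lemma cont_inv: "continuous_on {a..b} (\<lambda>x. 1 / f x)"
  using nz by (intro continuous_intros cont) auto

lemma log_deriv_L2: "log_deriv \<in> L2 J"
  using L2_mult_continuous[OF cont_inv sobolev_1D(2)[OF ab f]] by (simp add: log_deriv_def[abs_def])

lemma inv_f:
  shows "(\<lambda>x. 1 / f x) \<in> W12" and "AE x in M. wderiv J (\<lambda>x. 1 / f x) x = - log_deriv x / f x"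
proof -
  have V: "has_ac_version a b (\<lambda>x. 1 / f x) (\<lambda>x. - wderiv J f x / (f x)\<^sup>2)"
    using has_ac_deriv_inverse[OF f_ac nz] by (auto simp: has_ac_version_def)
  have eq: "(\<lambda>x. - wderiv J f x / (f x)\<^sup>2) = (\<lambda>x. - (1 / f x * log_deriv x))"
    by (simp add: log_deriv_def power2_eq_square)
  show "(\<lambda>x. 1 / f x) \<in> W12"
    by (rule sobolev_1I[OF ab V]) (unfold eq, intro L2_minus L2_mult_continuous cont_inv log_deriv_L2)
  show "AE x in M. wderiv J (\<lambda>x. 1 / f x) x = - log_deriv x / f x"
    using has_ac_version_wderiv(1)[OF ab V] by (simp add: log_deriv_def power2_eq_square)
qed

lemma div_f: "y \<in> W12 \<Longrightarrow> (\<lambda>x. y x / f x) \<in> W12"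
  using sobolev_1_mult[OF ab _ inv_f(1), of y] by simp

lemma wderiv_div_f:
  assumes y: "y \<in> W12"
  shows "AE x in M. wderiv J (\<lambda>x. y x / f x) x = (wderiv J y x - log_deriv x * y x) / f x"
  using wderiv_mult[OF ab y inv_f(1)] inv_f(2)
  by eventually_elim (simp add: diff_divide_distrib mult.commute)

lemma darboux_AE:
  assumes y: "y \<in> W12"
  shows "AE x in M. darboux J f y x = wderiv J y x - log_deriv x * y x"
  using wderiv_div_f[OF y] AE_f_nz by eventually_elim (simp add: darboux_def)

lemma darboux_L2:
  assumes y: "y \<in> W12"
  shows "darboux J f y \<in> L2 J"
proof (rule L2_cong_AE)
  show "(\<lambda>x. wderiv J y x - log_deriv x * y x) \<in> L2 J"
    using has_ac_version_L2_mult[OF sobolev_1D(1)[OF ab y] log_deriv_L2]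
    by (intro L2_diff sobolev_1D(2)[OF ab y]) (simp add: mult.commute)
  show "AE x in M. wderiv J y x - log_deriv x * y x = darboux J f y x"
    by (rule AE_symmetric[OF darboux_AE[OF y]])
qed

lemma darboux_inverse_AE:
  assumes w: "w \<in> W12"
  shows "AE x in M. darboux J (\<lambda>t. 1 / f t) w x = wderiv J w x + log_deriv x * w x"
proof -
  have "AE x in M. wderiv J (\<lambda>x. w x * f x) x = wderiv J w x * f x + w x * wderiv J f x"
    by (rule wderiv_mult[OF ab w f])
  then show ?thesis using AE_f_nz
    by eventually_elim (simp add: darboux_def log_deriv_def field_simps)
qed

text \<open>With p = f'/f the product rule for y \<phi> gives y' \<phi>' + p^2 y \<phi> - p (y'
  \<phi> + y \<phi>') = (y' - p y) \<phi>' - p (y' - p y) \<phi> almost everywhere. The second claim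
  lets the right-hand integral be split where it is used.\<close>

lemma S_dist_eq:
  assumes y: "y \<in> W12" and \<phi>: "\<phi> \<in> W12"
  shows "S_dist J f y \<phi> = (LINT x|M. darboux J f y x * wderiv J \<phi> x - log_deriv x * darboux J f y x * \<phi> x)"
    and "integrable M (\<lambda>x. log_deriv x * darboux J f y x * \<phi> x)"
proof -
  note Y = sobolev_1D[OF ab y] and P = sobolev_1D[OF ab \<phi>]
  have y\<phi>: "(\<lambda>x. y x * \<phi> x) \<in> W12" by (rule sobolev_1_mult[OF ab y \<phi>])
  note Q = sobolev_1D[OF ab y\<phi>]
  have py: "(\<lambda>x. log_deriv x * (y x * \<phi> x)) \<in> L2 J"
    using has_ac_version_L2_mult[OF Q(1) log_deriv_L2] by (simp add: mult.commute)
  have "integrable M (\<lambda>x. log_deriv x * (log_deriv x * (y x * \<phi> x)))"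
    by (intro L2_mult_integrable log_deriv_L2 py)
  then have i1: "integrable M (\<lambda>x. (wderiv J f x / f x)\<^sup>2 * (y x * \<phi> x))"
    by (simp add: log_deriv_def power2_eq_square mult.assoc)
  have i2: "integrable M (\<lambda>x. wderiv J f x / f x * wderiv J (\<lambda>x. y x * \<phi> x) x)"
    using L2_mult_integrable[OF log_deriv_L2 Q(2)] by (simp add: log_deriv_def)
  have i3: "integrable M (\<lambda>x. wderiv J y x * wderiv J \<phi> x)"
    by (intro L2_mult_integrable Y P)
  have "(\<lambda>x. \<phi> x * darboux J f y x) \<in> L2 J"
    by (rule has_ac_version_L2_mult[OF P(1) darboux_L2[OF y]])
  from L2_mult_integrable[OF log_deriv_L2 this]
  show i4: "integrable M (\<lambda>x. log_deriv x * darboux J f y x * \<phi> x)"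
    by (simp add: mult_ac)
  have i5: "integrable M (\<lambda>x. darboux J f y x * wderiv J \<phi> x)"
    by (intro L2_mult_integrable darboux_L2[OF y] P)
  let ?g = "\<lambda>x. wderiv J y x * wderiv J \<phi> x + ((wderiv J f x / f x)\<^sup>2 * (y x * \<phi> x)
     - wderiv J f x / f x * wderiv J (\<lambda>x. y x * \<phi> x) x)"
  have "S_dist J f y \<phi> = (LINT x|M. ?g x)"
    unfolding S_dist_def q_dist_def using i1 i2 i3 by simp
  also have "\<dots> = (LINT x|M. darboux J f y x * wderiv J \<phi> x - log_deriv x * darboux J f y x * \<phi> x)"
  proof (rule integral_cong_AE)
    show "?g \<in> borel_measurable M"
      using i1 i2 i3 by (intro borel_measurable_integrable Bochner_Integration.integrable_add Bochner_Integration.integrable_diff)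
    show "(\<lambda>x. darboux J f y x * wderiv J \<phi> x - log_deriv x * darboux J f y x * \<phi> x) \<in> borel_measurable M"
      using i4 i5 by (intro borel_measurable_integrable Bochner_Integration.integrable_diff)
    show "AE x in M. ?g x = darboux J f y x * wderiv J \<phi> x - log_deriv x * darboux J f y x * \<phi> x"
      using wderiv_mult[OF ab y \<phi>] darboux_AE[OF y]
    proof eventually_elim
      case (elim x)
      show ?case
        unfolding elim log_deriv_def[symmetric] by (simp add: power2_eq_square algebra_simps)
    qed
  qed
  finally show "S_dist J f y \<phi> = (LINT x|M. darboux J f y x * wderiv J \<phi> x - log_deriv x * darboux J f y x * \<phi> x)" .
qed

section \<open>Domain and factorisation\<close>

lemma S_eq_imp_darboux_W12:
  assumes y: "y \<in> W12" and S: "S_eq J f y g"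
  shows "darboux J f y \<in> W12"
proof -
  let ?w = "darboux J f y"
  have g: "g \<in> L2 J" using S by (simp add: S_eq_def)
  have w: "?w \<in> L2 J" by (rule darboux_L2[OF y])
  have int: "integrable M (\<lambda>x. - (g x + log_deriv x * ?w x))"
    by (intro integrable_minus Bochner_Integration.integrable_add L2_integrable[OF g] L2_mult_integrable log_deriv_L2 w)
  have "has_weak_derivative J ?w (\<lambda>x. - (g x + log_deriv x * ?w x))"
    unfolding has_weak_derivative_def
  proof (intro conjI ballI)
    show "locally_integrable J ?w" "locally_integrable J (\<lambda>x. - (g x + log_deriv x * ?w x))"
      by (intro integrable_imp_locally_integrable int L2_integrable[OF w])+
    fix \<phi> assume t: "\<phi> \<in> test_functions J"
    note \<phi> = test_function_sobolev_1[OF ab t]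
    note P = sobolev_1D[OF ab \<phi>(1)]
    have i: "integrable M (\<lambda>x. ?w x * wderiv J \<phi> x)"  "integrable M (\<lambda>x. g x * \<phi> x)"
      by (intro L2_mult_integrable w g P)+
    have ae: "AE x in M. ?w x * wderiv J \<phi> x = ?w x * vector_derivative \<phi> (at x)"
      using \<phi>(2) by eventually_elim simp
    have "(LINT x|M. ?w x * vector_derivative \<phi> (at x)) = (LINT x|M. ?w x * wderiv J \<phi> x)"
      using i(1) borel_measurable_cong_AE_Ioo[OF _ ae] AE_symmetric[OF ae]
      by (intro integral_cong_AE) auto
    also have "\<dots> = S_dist J f y \<phi> + (LINT x|M. log_deriv x * ?w x * \<phi> x)"
      using i(1) S_dist_eq[OF y \<phi>(1)] by simp
    also have "S_dist J f y \<phi> = (LINT x|M. g x * \<phi> x)"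
      using S test_function_sobolev0[OF ab t] by (simp add: S_eq_def)
    also have "\<dots> + (LINT x|M. log_deriv x * ?w x * \<phi> x) = (LINT x|M. g x * \<phi> x + log_deriv x * ?w x * \<phi> x)"
      using i(2) S_dist_eq(2)[OF y \<phi>(1)] by simp
    also have "\<dots> = - (LINT x|M. - (g x + log_deriv x * ?w x) * \<phi> x)"
      by (simp add: algebra_simps flip: integral_minus)
    finally show "(LINT x|M. ?w x * vector_derivative \<phi> (at x)) = - (LINT x|M. - (g x + log_deriv x * ?w x) * \<phi> x)" .
  qed
  then have V: "has_ac_version a b ?w (\<lambda>x. - (g x + log_deriv x * ?w x))"
    by (rule has_weak_derivative_imp_has_ac_version[OF ab _ int])
  have "(\<lambda>x. log_deriv x * ?w x) \<in> L2 J"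
    using has_ac_version_L2_mult[OF V log_deriv_L2] by (simp add: mult.commute)
  then show ?thesis
    by (intro sobolev_1I[OF ab V] L2_minus L2_add g)
qed

text \<open>Here the identity is due for every \<phi> in \<open>sobolev0\<close>, so the derivative
  is moved off \<phi> by \<open>sobolev0_by_parts\<close>. The computation runs with ?g, which
  involves only w' + p w, and passes to the Darboux form ?g' by almost everywhere equality.\<close>

lemma S_eq_darboux:
  assumes y: "y \<in> W12" and w: "darboux J f y \<in> W12"
  shows "S_eq J f y (\<lambda>x. - darboux J (\<lambda>t. 1 / f t) (darboux J f y) x)"
proof -
  let ?w = "darboux J f y"
  let ?g = "\<lambda>x. - (wderiv J ?w x + log_deriv x * ?w x)"
  let ?g' = "\<lambda>x. - darboux J (\<lambda>t. 1 / f t) ?w x"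
  note W = sobolev_1D[OF ab w]
  have "(\<lambda>x. log_deriv x * ?w x) \<in> L2 J"
    using has_ac_version_L2_mult[OF W(1) log_deriv_L2] by (simp add: mult.commute)
  then have g: "?g \<in> L2 J"
    by (intro L2_minus L2_add W)
  have ae: "AE x in M. ?g x = ?g' x"
    using darboux_inverse_AE[OF w] by eventually_elim simp
  have g': "?g' \<in> L2 J" by (rule L2_cong_AE[OF g ae])
  have "S_dist J f y \<phi> = (LINT x|M. ?g' x * \<phi> x)" if \<phi>: "\<phi> \<in> sobolev0 J" for \<phi>
  proof -
    have s: "\<phi> \<in> W12" using \<phi> by (simp add: sobolev0_def)
    note P = sobolev_1D[OF ab s]
    have i: "integrable M (\<lambda>x. ?w x * wderiv J \<phi> x)" "integrable M (\<lambda>x. wderiv J ?w x * \<phi> x)"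
      by (intro L2_mult_integrable W P)+
    have "S_dist J f y \<phi> = (LINT x|M. ?w x * wderiv J \<phi> x) - (LINT x|M. log_deriv x * ?w x * \<phi> x)"
      using i S_dist_eq[OF y s] by simp
    also have "\<dots> = - (LINT x|M. wderiv J ?w x * \<phi> x + log_deriv x * ?w x * \<phi> x)"
      using sobolev0_by_parts[OF ab w \<phi>] i S_dist_eq(2)[OF y s] by simp
    also have "\<dots> = (LINT x|M. ?g x * \<phi> x)"
      by (simp add: algebra_simps flip: integral_minus)
    also have "\<dots> = (LINT x|M. ?g' x * \<phi> x)"
    proof (rule integral_cong_AE)
      show "AE x in M. ?g x * \<phi> x = ?g' x * \<phi> x"
        using ae by eventually_elim simp
    qed (intro borel_measurable_times L2_measurable g g' P)+
    finally show ?thesis .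
  qed
  then show ?thesis
    using g' by (simp add: S_eq_def)
qed

lemma S_domain_eq: "S_domain J f = {y \<in> W12. darboux J f y \<in> W12}"
  unfolding S_domain_def using S_eq_imp_darboux_W12 S_eq_darboux by blast

lemma S_domain_div_f:
  assumes "y \<in> S_domain J f"
  shows "(\<lambda>x. y x / f x) \<in> sobolev 2 J"
proof -
  have y: "y \<in> W12" "darboux J f y \<in> W12"
    using assms by (auto simp: S_domain_eq)
  have "wderiv J (\<lambda>x. y x / f x) \<in> W12"
  proof (rule sobolev_1_cong_AE[OF ab div_f[OF y(2)]])
    show "AE x in M. darboux J f y x / f x = wderiv J (\<lambda>x. y x / f x) x"
      using AE_f_nz by eventually_elim (simp add: darboux_def)
  qed
  then show ?thesis
    by (rule sobolev_2I[OF ab sobolev_1D(1)[OF ab div_f[OF y(1)]]])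
qed

lemma sobolev_2_mult_f:
  assumes u: "u \<in> sobolev 2 J"
  shows "(\<lambda>x. f x * u x) \<in> S_domain J f"
proof -
  note U = sobolev_2D[OF ab u]
  have fu: "(\<lambda>x. f x * u x) \<in> W12" by (rule sobolev_1_mult[OF ab f U(1)])
  have "darboux J f (\<lambda>x. f x * u x) \<in> W12"
  proof (rule sobolev_1_cong_AE[OF ab sobolev_1_mult[OF ab f U(2)]])
    \<comment> \<open>Outside J the function f may vanish, so \<open>u\<close> and f u / f can be
      different functions and \<open>wderiv\<close> may choose differently for them.\<close>
    have "AE x in M. u x = f x * u x / f x"
      using AE_f_nz by eventually_elim simp
    from wderiv_cong_AE[OF ab U(1) this]
    show "AE x in M. f x * wderiv J u x = darboux J f (\<lambda>x. f x * u x) x"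
      by eventually_elim (simp add: darboux_def)
  qed
  with fu show ?thesis by (simp add: S_domain_eq)
qed

section \<open>Division by f on classes modulo null sets\<close>

lemma f_measurable: "f \<in> borel_measurable M"
  by (rule L2_measurable[OF sobolev_1D(3)[OF ab f]])

lemma W12_measurable: "y \<in> W12 \<Longrightarrow> y \<in> borel_measurable M"
  by (rule L2_measurable[OF sobolev_1D(3)[OF ab]])

lemma ae_rel_class_eq_iff:
  assumes "u \<in> borel_measurable M" "v \<in> borel_measurable M"
  shows "ae_rel J `` {u} = ae_rel J `` {v} \<longleftrightarrow> (AE x in M. u x = v x)"
proof
  assume eq: "ae_rel J `` {u} = ae_rel J `` {v}"
  have "v \<in> ae_rel J `` {v}" using assms by (simp add: ae_rel_def)
  then have "v \<in> ae_rel J `` {u}" using eq by simp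
  then show "AE x in M. u x = v x" by (simp add: ae_rel_def)
next
  assume ae: "AE x in M. u x = v x"
  have "(AE x in M. u x = w x) \<longleftrightarrow> (AE x in M. v x = w x)" for w
    by (intro eventually_cong[OF ae]) auto
  then show "ae_rel J `` {u} = ae_rel J `` {v}"
    using assms by (auto simp: ae_rel_def)
qed

text \<open>Well-definedness on classes: every representative contributes the same class to the
  union.\<close>

lemma div_f_class:
  assumes y: "y \<in> borel_measurable M"
  shows "(\<Union>z\<in>ae_rel J `` {y}. ae_rel J `` {\<lambda>x. z x / f x}) = ae_rel J `` {\<lambda>x. y x / f x}"
proof -
  have "ae_rel J `` {\<lambda>x. z x / f x} = ae_rel J `` {\<lambda>x. y x / f x}" if "z \<in> ae_rel J `` {y}" for z
  proof -
    have z: "z \<in> borel_measurable M" "AE x in M. y x = z x"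
      using that by (auto simp: ae_rel_def)
    have "AE x in M. z x / f x = y x / f x"
      using z(2) by eventually_elim simp
    then show ?thesis
      by (subst ae_rel_class_eq_iff) (intro borel_measurable_divide y z f_measurable)+
  qed
  moreover have "y \<in> ae_rel J `` {y}"
    using y by (simp add: ae_rel_def)
  ultimately show ?thesis by blast
qed

text \<open>The inverse is induced by multiplication with f. Classes are essential: f is known to be
  nonzero only on the closed interval, so division can be undone only up to values outside
  J.\<close>

lemma bij_betw_div_f:
  "bij_betw (\<lambda>Y. \<Union>y\<in>Y. ae_rel J `` {\<lambda>x. y x / f x})
     (S_domain J f // ae_rel J) (sobolev 2 J // ae_rel J)"
proof -
  let ?\<Phi> = "\<lambda>Y. \<Union>y\<in>Y. ae_rel J `` {\<lambda>x. y x / f x}"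
  have meas: "y \<in> borel_measurable M" if "y \<in> S_domain J f" for y
    using that W12_measurable by (simp add: S_domain_def)
  have \<Phi>: "?\<Phi> (ae_rel J `` {y}) = ae_rel J `` {\<lambda>x. y x / f x}" if "y \<in> S_domain J f" for y
    by (rule div_f_class[OF meas[OF that]])
  have inj: "inj_on ?\<Phi> (S_domain J f // ae_rel J)"
  proof (rule inj_onI)
    fix X Y assume "X \<in> S_domain J f // ae_rel J" "Y \<in> S_domain J f // ae_rel J" and eq: "?\<Phi> X = ?\<Phi> Y"
    then obtain y z where y: "y \<in> S_domain J f" "X = ae_rel J `` {y}" and z: "z \<in> S_domain J f" "Y = ae_rel J `` {z}"
      by (elim quotientE) blast
    have "ae_rel J `` {\<lambda>x. y x / f x} = ae_rel J `` {\<lambda>x. z x / f x}"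
      using eq \<Phi>[OF y(1)] \<Phi>[OF z(1)] by (simp only: y(2) z(2))
    then have "AE x in M. y x / f x = z x / f x"
      by (subst (asm) ae_rel_class_eq_iff) (intro borel_measurable_divide meas y(1) z(1) f_measurable)+
    then have "AE x in M. y x = z x"
      using AE_f_nz by eventually_elim simp
    then show "X = Y"
      unfolding y(2) z(2) by (subst ae_rel_class_eq_iff) (intro meas y(1) z(1))+
  qed
  have "?\<Phi> ` (S_domain J f // ae_rel J) = sobolev 2 J // ae_rel J"
  proof (intro equalityI subsetI)
    fix Z assume "Z \<in> ?\<Phi> ` (S_domain J f // ae_rel J)"
    then obtain y where y: "y \<in> S_domain J f" "Z = ?\<Phi> (ae_rel J `` {y})"
      by (auto elim!: quotientE)
    then show "Z \<in> sobolev 2 J // ae_rel J"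
      unfolding y(2) \<Phi>[OF y(1)] by (intro quotientI S_domain_div_f)
  next
    fix Z assume "Z \<in> sobolev 2 J // ae_rel J"
    then obtain u where u: "u \<in> sobolev 2 J" "Z = ae_rel J `` {u}"
      by (elim quotientE)
    note fu = sobolev_2_mult_f[OF u(1)]
    have "AE x in M. u x = f x * u x / f x"
      using AE_f_nz by eventually_elim simp
    then have "Z = ae_rel J `` {\<lambda>x. f x * u x / f x}"
      unfolding u(2)
      by (subst ae_rel_class_eq_iff)
        (intro borel_measurable_divide meas[OF fu] f_measurable W12_measurable[OF sobolev_2D(1)[OF ab u(1)]])+
    also have "\<dots> = ?\<Phi> (ae_rel J `` {\<lambda>x. f x * u x})"
      by (rule \<Phi>[OF fu, symmetric])
    finally show "Z \<in> ?\<Phi> ` (S_domain J f // ae_rel J)"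
      using quotientI[OF fu, of "ae_rel J"] by blast
  qed
  with inj show ?thesis by (simp add: bij_betw_def)
qed

section \<open>Values at x0\<close>

lemma log_deriv_sq_int_tendsto_0:
  assumes x0: "x0 \<in> {a..b}"
  shows "(log_deriv_sq_int J f x0 \<longlongrightarrow> 0) (at x0 within J)"
proof -
  define h where "h = (\<lambda>t. (wderiv J f t / f t)\<^sup>2)"
  have "integrable M h"
    using L2_mult_integrable[OF log_deriv_L2 log_deriv_L2] by (simp add: h_def log_deriv_def power2_eq_square)
  then have h: "h absolutely_integrable_on {a..b}" by (simp only: integrable_Ioo_iff)
  define H where "H = (\<lambda>x. integral {a..x} h)"
  have H: "has_ac_deriv a b H h"
    by (rule has_ac_derivI[OF h]) (simp add: H_def)
  have set_int: "(LINT t:{x<..<y}|lebesgue. h t) = H y - H x" if "a \<le> x" "x \<le> y" "y \<le> b" for x y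
  proof -
    have hxy: "h absolutely_integrable_on {x..y}"
      by (rule absolutely_integrable_subintervalD[OF h that(1,3)])
    then have "(LINT t:{x<..<y}|lebesgue. h t) = integral {x<..<y} h"
      unfolding absolutely_integrable_on_Icc_iff_Ioo by (rule set_lebesgue_integral_eq_integral(2))
    then show ?thesis
      using has_ac_deriv_increment[OF H that] by (simp add: integral_open_interval_real)
  qed
  \<comment> \<open>The oriented integral changes sign when x lies to the left of x0, hence the two
    instances of \<open>set_int\<close>.\<close>
  have eq: "log_deriv_sq_int J f x0 x = H x - H x0" if "x \<in> {a..b}" for x
    using set_int[of x0 x] set_int[of x x0] x0 that
    by (auto simp: log_deriv_sq_int_def interval_lebesgue_integral_def h_def[symmetric])
  have "(H \<longlongrightarrow> H x0) (at x0 within {a..b})"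
    using has_ac_deriv_continuous_on[OF H] x0 by (simp add: continuous_on_def)
  then have "((\<lambda>x. H x - H x0) \<longlongrightarrow> H x0 - H x0) (at x0 within J)"
    by (intro tendsto_intros) (auto elim: tendsto_within_subset)
  then have "((\<lambda>x. H x - H x0) \<longlongrightarrow> 0) (at x0 within J)" by simp
  then show ?thesis
    by (rule Lim_transform_eventually) (use eq in \<open>auto simp: eventually_at_filter\<close>)
qed

lemma quasideriv_AE:
  assumes y: "y \<in> W12"
  shows "AE x in M. quasideriv J (sigma_f J f x0) y x = darboux J f y x - y x * log_deriv_sq_int J f x0 x"
  using darboux_AE[OF y] by eventually_elim (simp add: quasideriv_def sigma_f_def log_deriv_def algebra_simps)

lemma has_point_value_add:
  assumes "has_point_value J u x0 c" "has_point_value J v x0 d" "AE x in M. w x = u x + v x"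
  shows "has_point_value J w x0 (c + d)"
proof -
  obtain u' v' where u': "AE x in M. u x = u' x" "(u' \<longlongrightarrow> c) (at x0 within J)"
    and v': "AE x in M. v x = v' x" "(v' \<longlongrightarrow> d) (at x0 within J)"
    using assms by (auto simp: has_point_value_def)
  have "AE x in M. w x = u' x + v' x"
    using u'(1) v'(1) assms(3) by eventually_elim simp
  moreover have "((\<lambda>x. u' x + v' x) \<longlongrightarrow> c + d) (at x0 within J)"
    by (intro tendsto_add u' v')
  ultimately show ?thesis
    unfolding has_point_value_def by (intro exI[of _ "\<lambda>x. u' x + v' x"]) simp
qed

text \<open>The quasiderivative and the Darboux transform differ by the continuous version Y of y
  times an integral tending to 0 at x0, and Y has a finite limit there. Adding a function of point
  value 0 transfers point values in both directions, whether or not they exist.\<close>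

lemma point_values:
  assumes x0: "x0 \<in> {a..b}" and y: "y \<in> W12"
  shows "has_point_value J (\<lambda>x. quasideriv J (sigma_f J f x0) y x - darboux J f y x) x0 0"
    and "has_point_value J (quasideriv J (sigma_f J f x0) y) x0 c \<longleftrightarrow> has_point_value J (darboux J f y) x0 c"
proof -
  obtain Y where Y: "has_ac_deriv a b Y (wderiv J y)" "AE x in M. y x = Y x"
    using sobolev_1D(1)[OF ab y] by (auto simp: has_ac_version_def)
  have "(Y \<longlongrightarrow> Y x0) (at x0 within {a..b})"
    using has_ac_deriv_continuous_on[OF Y(1)] x0 by (simp add: continuous_on_def)
  then have "(Y \<longlongrightarrow> Y x0) (at x0 within J)"
    by (rule tendsto_within_subset) auto
  then have lim: "((\<lambda>x. Y x * log_deriv_sq_int J f x0 x) \<longlongrightarrow> 0) (at x0 within J)"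
    using tendsto_mult[OF _ log_deriv_sq_int_tendsto_0[OF x0]] by fastforce
  have ae1: "AE x in M. quasideriv J (sigma_f J f x0) y x - darboux J f y x = - (Y x * log_deriv_sq_int J f x0 x)"
    using quasideriv_AE[OF y, of x0] Y(2) by eventually_elim simp
  then have ae2: "AE x in M. darboux J f y x - quasideriv J (sigma_f J f x0) y x = Y x * log_deriv_sq_int J f x0 x"
    by eventually_elim (simp add: algebra_simps)
  show 1: "has_point_value J (\<lambda>x. quasideriv J (sigma_f J f x0) y x - darboux J f y x) x0 0"
    unfolding has_point_value_def using ae1 tendsto_minus[OF lim] by (intro exI conjI) auto
  have 2: "has_point_value J (\<lambda>x. darboux J f y x - quasideriv J (sigma_f J f x0) y x) x0 0"
    unfolding has_point_value_def using ae2 lim by (intro exI conjI) auto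
  show "has_point_value J (quasideriv J (sigma_f J f x0) y) x0 c \<longleftrightarrow> has_point_value J (darboux J f y) x0 c"
    using has_point_value_add[OF _ 1, of "darboux J f y" c "quasideriv J (sigma_f J f x0) y"]
      has_point_value_add[OF _ 2, of "quasideriv J (sigma_f J f x0) y" c "darboux J f y"] by auto
qed

end

theorem theorem7:
  fixes a b x0 :: real and J :: "real set" and f :: "real \<Rightarrow> complex"
  assumes "a < b" and "J = {a<..<b}" and "x0 \<in> closure J"
    and "f \<in> sobolev 1 J" and "continuous_on (closure J) f"
    and "\<forall>x\<in>closure J. f x \<noteq> 0" and "f x0 = 1"
  shows
    "(\<forall>y\<in>sobolev 1 J. AE x in lebesgue_on J.
        quasideriv J (sigma_f J f x0) y x = darboux J f y x - y x * log_deriv_sq_int J f x0 x)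
   \<and> (\<forall>y\<in>sobolev 1 J.
        (\<forall>c. has_point_value J (quasideriv J (sigma_f J f x0) y) x0 c
             \<longleftrightarrow> has_point_value J (darboux J f y) x0 c) \<and>
        has_point_value J (\<lambda>x. quasideriv J (sigma_f J f x0) y x - darboux J f y x) x0 0)
   \<and> S_domain J f = {y \<in> sobolev 1 J. darboux J f y \<in> sobolev 1 J}
   \<and> bij_betw (\<lambda>Y. \<Union>y\<in>Y. ae_rel J `` {\<lambda>x. y x / f x})
        (S_domain J f // ae_rel J) (sobolev 2 J // ae_rel J)
   \<and> (\<forall>y\<in>S_domain J f. S_eq J f y (\<lambda>x. - darboux J (\<lambda>t. 1 / f t) (darboux J f y) x))"
proof -
  have cl: "closure J = {a..b}"
    using assms by simp
  interpret N: nonvanishing_sobolev a b f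
    using assms unfolding cl by unfold_locales auto
  show ?thesis
    unfolding \<open>J = {a<..<b}\<close>
    using N.quasideriv_AE N.point_values assms(3) N.S_domain_eq N.bij_betw_div_f N.S_eq_darboux
    unfolding cl by blast
qed

end
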